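(* For any Coxeter group $W$ and any $w\in W$ with $w\neq 1$, $$\Psi_{[1,w]}\le\Psi_{B_{l(w)}},$$ where $\le$ denotes coefficientwise comparison of ab-indices; equivalently, $\beta_{[1,w]}(S)\le\beta_{B_{l(w)}}(S)$ for every $S\subseteq\{1,\dots,l(w)-1\}$.
   Context: $l$ is the length function, $[1,w]$ is the lower interval in Bruhat order (fixing a reduced word for $w$, $v\le w$ iff some subword is a reduced word for $v$), and $B_n$ is the Boolean algebra of rank $n$ (all subsets of an $n$-element set ordered by inclusion). For a finite graded poset $P$ of rank $n+1\ge1$ with minimum $\hat0$ and maximum $\hat1$ and $S\subseteq[n]=\{1,\dots,n\}$, let $\alpha_P(S)$ be the number of chains in $P\setminus\{\hat0,\hat1\}$ whose set of ranks is exactly $S$; the flag h-vector is $\beta_P(S)=\sum_{T\subseteq S}(-1)^{|S\setminus T|}\alpha_P(T)$. The ab-index is $\Psi_P=\sum_{S\subseteq[n]}\beta_P(S)u_S$, where $u_S=u_1\cdots u_n$ is the monomial in non-commuting variables $a,b$ with $u_i=b$ if $i\in S$ and $u_i=a$ otherwise. *)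

theory Defs
  imports "HOL-Algebra.Generated_Groups" "HOL-Library.Extended_Nat" "HOL-Library.Sublist"
    "HOL-Library.Poly_Mapping"
begin

section \<open>Coxeter systems\<close>

definition word_prod :: "('a, 'b) monoid_scheme \<Rightarrow> 'a list \<Rightarrow> 'a" where
  "word_prod G ws = foldr (\<lambda>x y. x \<otimes>\<^bsub>G\<^esub> y) ws \<one>\<^bsub>G\<^esub>"

text \<open>One insertion of a relator \<open>(st)\<^sup>m\<close>, with \<open>m = m(s,t)\<close> finite, into a word over \<open>S\<close>.\<close>

inductive coxeter_step :: "'a set \<Rightarrow> ('a \<Rightarrow> 'a \<Rightarrow> enat) \<Rightarrow> 'a list \<Rightarrow> 'a list \<Rightarrow> bool"
  for S m where
  "us \<in> lists S \<Longrightarrow> vs \<in> lists S \<Longrightarrow> s \<in> S \<Longrightarrow> t \<in> S \<Longrightarrow> m s t = enat k \<Longrightarrow>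
    coxeter_step S m (us @ vs) (us @ concat (replicate k [s, t]) @ vs)"

text \<open>
  \<open>W\<close> is presented by the generators \<open>S\<close> and the relations \<open>(st)\<^sup>m = 1\<close>, \<open>m = m(s,t)\<close>
  finite. Since \<open>m(s,s) = 1\<close>, every generator is its own inverse modulo the relations, so
  words without formal inverses suffice: the group is the free monoid on \<open>S\<close> modulo insertion
  and deletion of relators.
\<close>

locale coxeter_system = group W for W (structure) +
  fixes S :: "'a set" and m :: "'a \<Rightarrow> 'a \<Rightarrow> enat"
  assumes gens_closed: "S \<subseteq> carrier W"
    and gens_generate: "generate W S = carrier W"
    and matrix_diag: "s \<in> S \<Longrightarrow> m s s = 1"
    and matrix_off_diag: "s \<in> S \<Longrightarrow> t \<in> S \<Longrightarrow> s \<noteq> t \<Longrightarrow> 2 \<le> m s t"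
    and matrix_sym: "s \<in> S \<Longrightarrow> t \<in> S \<Longrightarrow> m s t = m t s"
    and presentation: "us \<in> lists S \<Longrightarrow> vs \<in> lists S \<Longrightarrow>
      word_prod W us = word_prod W vs \<longleftrightarrow> equivclp (coxeter_step S m) us vs"

definition cox_length :: "('a, 'b) monoid_scheme \<Rightarrow> 'a set \<Rightarrow> 'a \<Rightarrow> nat" where
  "cox_length W S w = (LEAST k. \<exists>ws \<in> lists S. word_prod W ws = w \<and> length ws = k)"

definition reduced_word :: "('a, 'b) monoid_scheme \<Rightarrow> 'a set \<Rightarrow> 'a \<Rightarrow> 'a list \<Rightarrow> bool" where
  "reduced_word W S w ws \<longleftrightarrow>
    ws \<in> lists S \<and> word_prod W ws = w \<and> length ws = cox_length W S w"

text \<open>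
  By the subword property the relation does not depend on the reduced word chosen for \<open>w\<close>,
  so the choice is expressed by an existential quantifier.
\<close>

definition bruhat :: "('a, 'b) monoid_scheme \<Rightarrow> 'a set \<Rightarrow> 'a rel" where
  "bruhat W S = {(v, w). \<exists>ws. reduced_word W S w ws \<and>
     (\<exists>vs. subseq vs ws \<and> reduced_word W S v vs)}"

text \<open>Posets are given by their order relation \<open>r\<close>; the underlying set is \<open>Field r\<close>.\<close>

definition bruhat_interval :: "('a, 'b) monoid_scheme \<Rightarrow> 'a set \<Rightarrow> 'a \<Rightarrow> 'a \<Rightarrow> 'a rel" where
  "bruhat_interval W S u w =
    Restr (bruhat W S) {x. (u, x) \<in> bruhat W S \<and> (x, w) \<in> bruhat W S}"

definition boolean_poset :: "nat \<Rightarrow> nat set rel" where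
  "boolean_poset n = {(A, B). A \<subseteq> B \<and> B \<subseteq> {1..n}}"


section \<open>Flag vectors and the ab-index of a finite graded poset\<close>

definition poset_bot :: "'a rel \<Rightarrow> 'a" where
  "poset_bot r = (THE x. x \<in> Field r \<and> (\<forall>y \<in> Field r. (x, y) \<in> r))"

definition poset_top :: "'a rel \<Rightarrow> 'a" where
  "poset_top r = (THE x. x \<in> Field r \<and> (\<forall>y \<in> Field r. (y, x) \<in> r))"

text \<open>
  The rank of an element is the maximal length of a chain ending in it, a chain with \<open>k\<close>
  elements having length \<open>k - 1\<close>. In a finite graded poset this is the rank function.
\<close>

definition elem_rank :: "'a rel \<Rightarrow> 'a \<Rightarrow> nat" where
  "elem_rank r x = Max {card C | C. C \<in> Chains r \<and> C \<subseteq> under r x} - 1"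

definition poset_rank :: "'a rel \<Rightarrow> nat" where
  "poset_rank r = Max {card C | C. C \<in> Chains r} - 1"

definition flag_f :: "'a rel \<Rightarrow> nat set \<Rightarrow> nat" where
  "flag_f r S = card {C \<in> Chains r. C \<subseteq> Field r - {poset_bot r, poset_top r} \<and>
     elem_rank r ` C = S}"

definition flag_h :: "'a rel \<Rightarrow> nat set \<Rightarrow> int" where
  "flag_h r S = (\<Sum>T \<in> Pow S. (-1) ^ card (S - T) * int (flag_f r T))"

text \<open>
  Polynomials in the non-commuting variables \<open>a\<close>, \<open>b\<close> are finitely supported maps from words
  in \<open>a\<close>, \<open>b\<close> to their coefficients.
\<close>

datatype ab_var = Var_a | Var_b

definition ab_monomial :: "nat \<Rightarrow> nat set \<Rightarrow> ab_var list" where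
  "ab_monomial n S = map (\<lambda>i. if i \<in> S then Var_b else Var_a) [1..<n + 1]"

definition ab_index :: "'a rel \<Rightarrow> ab_var list \<Rightarrow>\<^sub>0 int" where
  "ab_index r = (let n = poset_rank r - 1 in
     \<Sum>S \<in> Pow {1..n}. Poly_Mapping.single (ab_monomial n S) (flag_h r S))"

text \<open>The order that the library puts on \<open>\<Rightarrow>\<^sub>0\<close> is lexicographic, hence a separate definition.\<close>

definition coeffwise_le :: "('m \<Rightarrow>\<^sub>0 int) \<Rightarrow> ('m \<Rightarrow>\<^sub>0 int) \<Rightarrow> bool" where
  "coeffwise_le p q \<longleftrightarrow> (\<forall>u. Poly_Mapping.lookup p u \<le> Poly_Mapping.lookup q u)"

end

theory Submission
  imports Defs
begin

text \<open>
  The inequality is an inclusion of sets of permutations. Fix a reduced word of \<open>w\<close>, of length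
  \<open>n\<close>. Going down from \<open>w\<close> along a maximal chain of \<open>[1,w]\<close>, each covering step deletes one
  letter from the reduced word kept so far, by the exchange property; labelling the step by the
  position of that letter turns the chain into an ordering of the \<open>n\<close> positions. This is the
  labelling with which Bjoerner and Wachs proved that Bruhat order is lexicographically shellable.
  Different chains have different labels, so maximal chains are some of the permutations of the
  positions, namely those for which every initial segment (read from the bottom of the chain)
  spells a reduced word. In \<open>B\<^sub>n\<close> every permutation occurs.

  Labels compute the flag h-vector as soon as every interval below a given reduced word contains
  exactly one maximal chain whose deleted positions decrease on the way down: a chain with rank
  set \<open>T\<close> then has exactly one refinement to a maximal chain whose descents lie in \<open>T\<close>, and
  inclusion-exclusion gives that \<open>\<beta>(S)\<close> is the number of admissible permutations with descent set
  \<open>S\<close> (\<open>flag_h_eq\<close>). Applied to \<open>[1,w]\<close> and to \<open>B\<^sub>n\<close> this proves the theorem, since admissible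
  permutations of \<open>[1,w]\<close> are permutations.

  It remains to find the decreasing chains. Existence (\<open>ex_deletion\<close>) is a greedy choice: delete
  the last letter whose deletion leaves a reduced word of an element still above the target.
  That the choices decrease is \<open>later_deletion\<close>, a consequence of strong exchange. Uniqueness
  (\<open>deletion_determined\<close>) looks at the first letter \<open>s\<close>: it is deleted last or never, so whether
  it is deleted is decided by whether multiplication by \<open>s\<close> lengthens the target.

  The facts about Coxeter groups all come from the presentation: the parity of the number of times
  that a reflection occurs among the inversions of a word is unchanged by inserting a relator,
  hence is a function of the group element, and strong exchange follows.
\<close>

section \<open>Orders of insertion and their descents\<close>

text \<open>
  A maximal chain is recorded from the bottom upwards, as the order in which positions are inserted;
  the downward deletion order is the reverse list.
\<close>

definition insertion_orders :: "nat set set \<Rightarrow> nat set \<Rightarrow> nat list set" where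
  "insertion_orders F K = {ps. distinct ps \<and> set ps = K \<and> (\<forall>i. set (take i ps) \<in> F)}"

text \<open>
  The list is indexed from 0, so \<open>i\<close> is the number of positions inserted before the descent and
  hence the rank of the chain element at which the descent occurs.
\<close>

definition descents :: "nat list \<Rightarrow> nat set" where
  "descents ps = {i. 0 < i \<and> i < length ps \<and> ps ! i < ps ! (i - 1)}"

lemma descents_empty_iff: "descents ps = {} \<longleftrightarrow> sorted ps"
proof
  assume d: "descents ps = {}"
  have "ps ! i \<le> ps ! Suc i" if "Suc i < length ps" for i
  proof (rule ccontr)
    assume "\<not> ps ! i \<le> ps ! Suc i"
    then have "Suc i \<in> descents ps" using that by (simp add: descents_def)
    then show False using d by simp
  qed
  then show "sorted ps" by (simp add: sorted_iff_nth_Suc)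
next
  assume "sorted ps"
  then have "ps ! (i - 1) \<le> ps ! i" if "i < length ps" for i
    using that by (intro sorted_nth_mono) auto
  then show "descents ps = {}" by (fastforce simp: descents_def)
qed

text \<open>
  This splits an insertion order at the element of the largest rank \<open>t\<close> in a rank set: no condition
  is imposed at \<open>t\<close> itself, and above \<open>t\<close> the order has to be increasing.
\<close>

lemma descents_append_subset_iff:
  assumes "length ps = t" and "T \<subseteq> {..<t}"
  shows "descents (ps @ qs) \<subseteq> insert t T \<longleftrightarrow> descents ps \<subseteq> T \<and> sorted qs"
proof -
  have below: "i \<in> descents (ps @ qs) \<longleftrightarrow> i \<in> descents ps" if "i < t" for i
    using that assms(1) by (auto simp: descents_def nth_append)
  have above: "i + t \<in> descents (ps @ qs) \<longleftrightarrow> i \<in> descents qs" if "0 < i" for i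
    using that assms(1) by (auto simp: descents_def nth_append)
  have small: "i < t" if "i \<in> descents ps" for i
    using that assms(1) by (simp add: descents_def)
  have pos: "0 < i" if "i \<in> descents qs" for i
    using that by (simp add: descents_def)
  show ?thesis unfolding descents_empty_iff[symmetric]
  proof (intro iffI conjI)
    assume sub: "descents (ps @ qs) \<subseteq> insert t T"
    show "descents ps \<subseteq> T" using below small sub by blast
    show "descents qs = {}"
    proof (rule equals0I)
      fix i assume i: "i \<in> descents qs"
      then have "i + t \<in> insert t T" using above[OF pos[OF i]] sub by blast
      then show False using pos[OF i] assms(2) by auto
    qed
  next
    assume sub: "descents ps \<subseteq> T \<and> descents qs = {}"
    show "descents (ps @ qs) \<subseteq> insert t T"
    proof
      fix i assume i: "i \<in> descents (ps @ qs)"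
      consider "i < t" | "i = t" | "t < i" by linarith
      then show "i \<in> insert t T"
      proof cases
        case 3
        then show ?thesis using above[of "i - t"] i sub by simp
      qed (use below i sub in auto)
    qed
  qed
qed

text \<open>
  Translates between the increasing list of a set of positions, whose prefixes are the intermediate
  words, and the set itself, for which being deleted in decreasing order is easier to express.
\<close>

lemma prefixes_of_sorted_list:
  fixes D :: "nat set"
  assumes "finite D"
  shows "(\<forall>q. P (D \<inter> {..<q})) \<longleftrightarrow> (\<forall>i. P (set (take i (sorted_list_of_set D))))"
proof -
  define xs where "xs = sorted_list_of_set D"
  have xs: "sorted_wrt (<) xs" "set xs = D"
    using assms by (simp_all add: xs_def)
  have "\<exists>q. set (take i xs) = D \<inter> {..<q}" for i
  proof (cases "drop i xs")
    case Nil
    have "D \<subseteq> {..<Suc (Max D)}" using assms by (auto simp: less_Suc_eq_le)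
    then have "set (take i xs) = D \<inter> {..<Suc (Max D)}" using Nil xs(2) by auto
    then show ?thesis by blast
  next
    case (Cons z zs)
    then have eq: "xs = take i xs @ z # zs" by (metis append_take_drop_id)
    then have D: "D = set (take i xs) \<union> insert z (set zs)"
      using xs(2) by (metis list.simps(15) set_append)
    have "sorted_wrt (<) (take i xs @ z # zs)" using xs(1) eq by simp
    then have "\<forall>x \<in> set (take i xs). x < z" and "\<forall>x \<in> set zs. z < x"
      by (simp_all add: sorted_wrt_append)
    then have "set (take i xs) = D \<inter> {..<z}" unfolding D by auto
    then show ?thesis by blast
  qed
  moreover have "\<exists>i. D \<inter> {..<q} = set (take i xs)" for q
  proof -
    let ?ys = "takeWhile (\<lambda>x. x < q) xs" and ?zs = "dropWhile (\<lambda>x. x < q) xs"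
    have eq: "xs = ?ys @ ?zs" by simp
    then have D: "D = set ?ys \<union> set ?zs" using xs(2) by (metis set_append)
    have "\<forall>x \<in> set ?zs. q \<le> x"
    proof (cases ?zs)
      case Nil
      then show ?thesis by (simp only: list.set ball_empty)
    next
      case (Cons z zs)
      have "sorted_wrt (<) (?ys @ z # zs)" using xs(1) eq Cons by metis
      then have "\<forall>x \<in> set zs. z < x" by (simp add: sorted_wrt_append)
      moreover have "q \<le> z" using Cons by (simp add: dropWhile_eq_Cons_conv)
      ultimately show ?thesis unfolding Cons by auto
    qed
    moreover have "\<forall>x \<in> set ?ys. x < q" by (auto dest: set_takeWhileD)
    ultimately have "D \<inter> {..<q} = set ?ys" unfolding D by auto
    then show ?thesis by (metis takeWhile_eq_take)
  qed
  ultimately show ?thesis unfolding xs_def by metis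
qed

lemma finite_insertion_orders: "finite (insertion_orders F K)"
proof (cases "finite K")
  case True
  then have "finite {ps. set ps \<subseteq> K \<and> distinct ps}" by (rule finite_subset_distinct)
  then show ?thesis by (rule rev_finite_subset) (auto simp: insertion_orders_def)
next
  case False
  then have "insertion_orders F K = {}" by (auto simp: insertion_orders_def)
  then show ?thesis by simp
qed


section \<open>Posets labelled by deletions\<close>

text \<open>
  The abstract form of the labelling: \<open>F\<close> is the family of admissible sets of kept positions,
  \<open>val\<close> the element that such a set represents (several sets may represent the same element), and
  \<open>rk\<close> its rank. The last assumption is the unique decreasing chain: if \<open>D\<close> is deleted from \<open>K\<close>
  in decreasing order, the sets passed through are \<open>K - (D \<inter> {q..})\<close>.
\<close>

locale deletion_labelling =
  fixes r :: "'p rel" and F :: "nat set set" and n :: nat and val :: "nat set \<Rightarrow> 'p"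
    and rk :: "'p \<Rightarrow> nat"
  assumes F_sub: "K \<in> F \<Longrightarrow> K \<subseteq> {..<n}"
    and full_in: "{..<n} \<in> F"
    and empty_in: "{} \<in> F"
    and trans_r: "trans r"
    and below_full: "x \<in> Field r \<Longrightarrow> (x, val {..<n}) \<in> r"
    and val_mono: "L \<in> F \<Longrightarrow> K \<in> F \<Longrightarrow> L \<subseteq> K \<Longrightarrow> (val L, val K) \<in> r"
    and rk_val: "K \<in> F \<Longrightarrow> rk (val K) = card K"
    and ex1_deletion: "K \<in> F \<Longrightarrow> (x, val K) \<in> r \<Longrightarrow>
      \<exists>!D. D \<subseteq> K \<and> (\<forall>q. K - (D \<inter> {q..}) \<in> F) \<and> val (K - D) = x"
begin

definition deletion :: "nat set \<Rightarrow> 'p \<Rightarrow> nat set" where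
  "deletion K x = (THE D. D \<subseteq> K \<and> (\<forall>q. K - (D \<inter> {q..}) \<in> F) \<and> val (K - D) = x)"

lemma deletion:
  assumes "K \<in> F" "(x, val K) \<in> r"
  shows "deletion K x \<subseteq> K" "K - (deletion K x \<inter> {q..}) \<in> F" "val (K - deletion K x) = x"
    "K - deletion K x \<in> F"
proof -
  have *: "deletion K x \<subseteq> K \<and> (\<forall>q. K - (deletion K x \<inter> {q..}) \<in> F) \<and> val (K - deletion K x) = x"
    unfolding deletion_def by (rule theI'[OF ex1_deletion[OF assms]])
  then show "deletion K x \<subseteq> K" "K - (deletion K x \<inter> {q..}) \<in> F" "val (K - deletion K x) = x"
    by auto
  have "K - (deletion K x \<inter> {0..}) \<in> F" using * by blast
  then show "K - deletion K x \<in> F" by simp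
qed

lemma deletion_unique:
  assumes "K \<in> F" "(x, val K) \<in> r" "D \<subseteq> K" "\<And>q. K - (D \<inter> {q..}) \<in> F" "val (K - D) = x"
  shows "D = deletion K x"
  using ex1_deletion[OF assms(1,2)] deletion[OF assms(1,2)] assms(3-) by blast

lemma finite_F: "K \<in> F \<Longrightarrow> finite K"
  using F_sub finite_subset by blast

lemma Field_val:
  assumes "x \<in> Field r" obtains K where "K \<in> F" "x = val K"
  using deletion(3,4)[OF full_in below_full[OF assms]] by metis

lemma val_Field: "K \<in> F \<Longrightarrow> val K \<in> Field r"
  using val_mono[of K K] by (auto simp: Field_def)

lemma refl_Field: "x \<in> Field r \<Longrightarrow> (x, x) \<in> r"
  by (metis Field_val val_mono order_refl)

lemma above_empty: "x \<in> Field r \<Longrightarrow> (val {}, x) \<in> r"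
  by (metis Field_val val_mono empty_in empty_subsetI)

text \<open>
  An element below \<open>val K\<close> is represented by a subset of \<open>K\<close>, so cardinalities decide.
\<close>

lemma rk_mono:
  assumes "(x, y) \<in> r"
  shows "rk x \<le> rk y" "rk x = rk y \<Longrightarrow> x = y"
proof -
  obtain K where K: "K \<in> F" "y = val K" using assms Field_val FieldI2 by metis
  note D = deletion[OF K(1) assms[unfolded K(2)]]
  have x: "x = val (K - deletion K x)" using D(3) by simp
  have cx: "rk x = card (K - deletion K x)" using D(3) rk_val[OF D(4)] by simp
  have cy: "rk y = card K" using K rk_val by simp
  have fin: "finite K" using K finite_F by simp
  show "rk x \<le> rk y" using cx cy fin by (simp add: card_mono)
  assume "rk x = rk y"
  then have "K - deletion K x = K" using cx cy fin by (simp add: card_subset_eq)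
  then show "x = y" using x K(2) by simp
qed

lemma antisym_rel: "(x, y) \<in> r \<Longrightarrow> (y, x) \<in> r \<Longrightarrow> x = y"
  using rk_mono by (metis le_antisym)

lemma poset_bot_eq: "poset_bot r = val {}"
  unfolding poset_bot_def
  by (rule the_equality) (use above_empty val_Field[OF empty_in] antisym_rel in blast)+

lemma poset_top_eq: "poset_top r = val {..<n}"
  unfolding poset_top_def
  by (rule the_equality) (use below_full val_Field[OF full_in] antisym_rel in blast)+

lemma finite_Field: "finite (Field r)"
proof (rule finite_subset)
  show "Field r \<subseteq> val ` F" using Field_val by blast
  have "F \<subseteq> Pow {..<n}" using F_sub by blast
  then show "finite (val ` F)" by (simp add: finite_subset)
qed

lemma Chains_subset_Field: "C \<in> Chains r \<Longrightarrow> C \<subseteq> Field r"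
  by (auto simp: Chains_def intro: FieldI1)

lemma inj_on_rk_Chains: "C \<in> Chains r \<Longrightarrow> inj_on rk C"
  by (auto simp: Chains_def inj_on_def) (metis rk_mono(2))

text \<open>
  The bottom element has rank 0, so only the empty set represents it; reaching it means deleting
  everything.
\<close>

lemma deletion_bot: assumes "K \<in> F" shows "deletion K (val {}) = K"
proof -
  have le: "(val {}, val K) \<in> r" by (rule above_empty[OF val_Field[OF assms]])
  have "card (K - deletion K (val {})) = rk (val {})"
    using deletion(3,4)[OF assms le] rk_val by metis
  then have "card (K - deletion K (val {})) = 0" using rk_val[OF empty_in] by simp
  then show ?thesis using deletion(1)[OF assms le] finite_F[OF assms] by auto
qed

lemma initial_segment_in:
  assumes "K \<in> F" shows "K \<inter> {..<q} \<in> F"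
proof -
  have "K - (K \<inter> {q..}) \<in> F"
    using deletion(2)[OF assms above_empty[OF val_Field[OF assms]], of q] deletion_bot[OF assms]
    by simp
  moreover have "K - (K \<inter> {q..}) = K \<inter> {..<q}" by auto
  ultimately show ?thesis by simp
qed

text \<open>
  The initial segments of \<open>K\<close> form a chain in which every rank up to that of \<open>val K\<close> occurs, which
  identifies \<open>rk\<close> with the rank defined by longest chains.
\<close>

lemma saturated_chain:
  assumes "K \<in> F"
  shows "\<exists>C. C \<in> Chains r \<and> C \<subseteq> under r (val K) \<and> rk ` C = {..card K}"
  using assms
proof (induction "card K" arbitrary: K)
  case 0
  then have "K = {}" using finite_F by auto
  then show ?case using refl_Field[OF val_Field[OF empty_in]] rk_val[OF empty_in]
    by (intro exI[of _ "{val {}}"]) (auto simp: Chains_def under_def)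
next
  case (Suc k)
  have fin: "finite K" and ne: "K \<noteq> {}" using Suc finite_F by auto
  let ?L = "K \<inter> {..<Max K}"
  have L: "?L = K - {Max K}" using fin by (auto simp: order_less_le)
  have LF: "?L \<in> F" by (rule initial_segment_in[OF Suc.prems])
  have k: "k = card ?L" using Suc(2) fin ne by (simp add: L)
  obtain C where C: "C \<in> Chains r" "C \<subseteq> under r (val ?L)" "rk ` C = {..card ?L}"
    using Suc.hyps(1)[OF k LF] by blast
  have "(x, val K) \<in> r" if "x \<in> C" for x
    using that C(2) val_mono[OF LF Suc.prems] trans_r
    by (auto simp: under_def dest: transD)
  then have "insert (val K) C \<in> Chains r \<and> insert (val K) C \<subseteq> under r (val K)"
    using C(1) refl_Field[OF val_Field[OF Suc.prems]] by (auto simp: Chains_def under_def)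
  moreover have "rk ` insert (val K) C = {..card K}"
    using C(3) rk_val[OF Suc.prems] k Suc(2) by (auto simp: atMost_Suc)
  ultimately show ?case by blast
qed

lemma Max_card_Chains:
  assumes "K \<in> F" and A: "A = {card C |C. C \<in> Chains r \<and> C \<subseteq> under r (val K)}"
  shows "Max A = Suc (card K)"
proof (rule Max_eqI)
  have le: "c \<le> Suc (card K)" if c: "c \<in> A" for c
  proof -
    obtain C where C: "c = card C" "C \<in> Chains r" "C \<subseteq> under r (val K)" using c A by auto
    have "rk ` C \<subseteq> {..card K}" using C(3) rk_mono(1) rk_val[OF assms(1)] by (force simp: under_def)
    then have "card C \<le> card {..card K}"
      by (intro card_inj_on_le[OF inj_on_rk_Chains[OF C(2)]]) auto
    then show ?thesis using C(1) by simp
  qed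
  then show "\<And>c. c \<in> A \<Longrightarrow> c \<le> Suc (card K)" .
  show "finite A" by (rule finite_subset[of _ "{..Suc (card K)}"]) (use le in auto)
  obtain C where C: "C \<in> Chains r" "C \<subseteq> under r (val K)" "rk ` C = {..card K}"
    using saturated_chain[OF assms(1)] by blast
  have "card C = Suc (card K)" using card_image[OF inj_on_rk_Chains[OF C(1)]] C(3) by simp
  then show "Suc (card K) \<in> A" using C A by force
qed

lemma elem_rank_eq: assumes "x \<in> Field r" shows "elem_rank r x = rk x"
proof -
  obtain K where "K \<in> F" "x = val K" by (rule Field_val[OF assms])
  then show ?thesis
    unfolding elem_rank_def using Max_card_Chains rk_val by simp
qed

lemma Chains_under_full: "C \<in> Chains r \<Longrightarrow> C \<subseteq> under r (val {..<n})"
  using Chains_subset_Field below_full by (auto simp: under_def)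

lemma poset_rank_eq: "poset_rank r = n"
proof -
  have "{card C |C. C \<in> Chains r} = {card C |C. C \<in> Chains r \<and> C \<subseteq> under r (val {..<n})}"
    using Chains_under_full by blast
  then show ?thesis unfolding poset_rank_def using Max_card_Chains[OF full_in] by simp
qed

text \<open>
  The two quantities to be compared; both satisfy the same recursion on the largest element of \<open>T\<close>.
\<close>

definition chains_under :: "'p \<Rightarrow> nat set \<Rightarrow> 'p set set" where
  "chains_under x T = {C \<in> Chains r. C \<subseteq> under r x \<and> rk ` C = T}"

definition orders_within :: "nat set \<Rightarrow> nat set \<Rightarrow> nat list set" where
  "orders_within K T = {ps \<in> insertion_orders F K. descents ps \<subseteq> T}"

lemma finite_chains_under: "finite (chains_under x T)"
  by (rule finite_subset[of _ "Pow (Field r)"])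
    (use Chains_subset_Field finite_Field in \<open>auto simp: chains_under_def\<close>)

lemma chains_under_insert:
  assumes "T \<subseteq> {..<t}" and x: "x \<in> Field r"
  shows "chains_under x (insert t T)
    = (\<Union>y \<in> {y \<in> under r x. rk y = t}. insert y ` chains_under y T)"
proof (intro equalityI subsetI)
  fix C assume "C \<in> chains_under x (insert t T)"
  then have C: "C \<in> Chains r" "C \<subseteq> under r x" "rk ` C = insert t T"
    by (auto simp: chains_under_def)
  then obtain y where y: "y \<in> C" "rk y = t" by (metis image_iff insertI1)
  let ?C = "C - {y}"
  have "rk ` ?C = rk ` C - {t}"
    using inj_on_image_set_diff[OF inj_on_rk_Chains[OF C(1)], of C "{y}"] y by auto
  then have rkC: "rk ` ?C = T" using C(3) assms(1) by auto
  have "(z, y) \<in> r" if z: "z \<in> ?C" for z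
  proof -
    have "rk z < rk y" using z rkC assms(1) y(2) by blast
    then have "(y, z) \<notin> r" using rk_mono(1) by fastforce
    then show ?thesis using C(1) z y by (auto simp: Chains_def)
  qed
  then have "?C \<in> chains_under y T"
    using C(1) rkC by (auto simp: chains_under_def Chains_def under_def)
  moreover have "C = insert y ?C" using y by auto
  ultimately show "C \<in> (\<Union>y \<in> {y \<in> under r x. rk y = t}. insert y ` chains_under y T)"
    using y C(2) by blast
next
  fix C assume "C \<in> (\<Union>y \<in> {y \<in> under r x. rk y = t}. insert y ` chains_under y T)"
  then obtain y C' where y: "(y, x) \<in> r" "rk y = t" and C': "C' \<in> chains_under y T"
    and C: "C = insert y C'" by (auto simp: under_def)
  have "(y, y) \<in> r" using y refl_Field FieldI1 by metis
  moreover have "(z, y) \<in> r" "(z, x) \<in> r" if "z \<in> C'" for z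
    using that C' y trans_r by (auto simp: chains_under_def under_def dest: transD)
  ultimately show "C \<in> chains_under x (insert t T)"
    using C' y unfolding C by (auto simp: chains_under_def Chains_def under_def)
qed

lemma card_chains_under_insert:
  assumes "T \<subseteq> {..<t}" and x: "x \<in> Field r"
  shows "card (chains_under x (insert t T))
    = (\<Sum>y \<in> {y \<in> under r x. rk y = t}. card (chains_under y T))"
proof -
  have fin: "finite {y \<in> under r x. rk y = t}"
    by (rule finite_subset[OF _ finite_Field]) (auto simp: under_def intro: FieldI1)
  have notin: "z \<notin> C" if "C \<in> chains_under y T" "rk z = t" for y z C
    using that assms(1) by (auto simp: chains_under_def)
  have eq: "y = z" if "insert y C = insert z C'" "rk y = t" "rk z = t"
    "C \<in> chains_under y T" "C' \<in> chains_under z T" for y z C C'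
  proof -
    have "z \<in> insert y C" using that(1) by blast
    then show ?thesis using notin[OF that(4,3)] by blast
  qed
  have "card (chains_under x (insert t T))
    = (\<Sum>y \<in> {y \<in> under r x. rk y = t}. card (insert y ` chains_under y T))"
    unfolding chains_under_insert[OF assms]
  proof (rule card_UN_disjoint[OF fin])
    show "\<forall>y \<in> {y \<in> under r x. rk y = t}. finite (insert y ` chains_under y T)"
      using finite_chains_under by blast
    show "\<forall>y \<in> {y \<in> under r x. rk y = t}. \<forall>z \<in> {y \<in> under r x. rk y = t}.
      y \<noteq> z \<longrightarrow> insert y ` chains_under y T \<inter> insert z ` chains_under z T = {}"
      using eq by (auto simp: image_iff disjoint_iff)
  qed
  also have "\<dots> = (\<Sum>y \<in> {y \<in> under r x. rk y = t}. card (chains_under y T))"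
  proof (rule sum.cong[OF refl])
    fix y assume y: "y \<in> {y \<in> under r x. rk y = t}"
    have "inj_on (insert y) (chains_under y T)"
    proof (rule inj_onI)
      fix C C' assume C: "C \<in> chains_under y T" "C' \<in> chains_under y T" "insert y C = insert y C'"
      then have "y \<notin> C" "y \<notin> C'" using notin y by blast+
      then show "C = C'" using C(3) by (simp add: insert_ident)
    qed
    then show "card (insert y ` chains_under y T) = card (chains_under y T)" by (rule card_image)
  qed
  finally show ?thesis .
qed

lemma deletion_sorted_iff:
  assumes "D \<subseteq> K" "K \<in> F"
  shows "(\<forall>q. K - (D \<inter> {q..}) \<in> F) \<longleftrightarrow>
    (\<forall>i. (K - D) \<union> set (take i (sorted_list_of_set D)) \<in> F)"
proof -
  have fin: "finite D" using assms finite_F finite_subset by blast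
  have "K - (D \<inter> {q..}) = (K - D) \<union> (D \<inter> {..<q})" for q using assms by auto
  then show ?thesis
    using prefixes_of_sorted_list[OF fin, of "\<lambda>X. (K - D) \<union> X \<in> F"] by simp
qed

text \<open>
  The part of an insertion order above rank \<open>t\<close> is increasing, so it is the unique decreasing
  deletion down to the element \<open>y\<close> of rank \<open>t\<close> on the chain. Given \<open>y\<close>, only the order below \<open>y\<close>
  remains to be chosen.
\<close>

lemma orders_within_insert:
  assumes "T \<subseteq> {..<t}" and K: "K \<in> F" and "t \<le> card K"
  shows "orders_within K (insert t T)
    = (\<Union>y \<in> {y \<in> under r (val K). rk y = t}.
        (\<lambda>ps. ps @ sorted_list_of_set (deletion K y)) ` orders_within (K - deletion K y) T)"
    (is "_ = ?R")
proof (intro equalityI subsetI)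
  fix ps assume "ps \<in> orders_within K (insert t T)"
  then have ps: "distinct ps" "set ps = K" "\<And>i. set (take i ps) \<in> F"
    "descents ps \<subseteq> insert t T" by (auto simp: orders_within_def insertion_orders_def)
  define us vs where "us = take t ps" and "vs = drop t ps"
  have uv: "ps = us @ vs" by (simp add: us_def vs_def)
  have len: "length us = t"
    using assms(3) ps(1,2) by (auto simp: us_def distinct_card)
  have dus: "descents us \<subseteq> T" and vs_sorted: "sorted vs"
    using ps(4) descents_append_subset_iff[OF len assms(1)] uv by auto
  let ?D = "set vs" and ?y = "val (set us)"
  have usF: "set us \<in> F" using ps(3) by (simp add: us_def)
  have us: "set us = K - ?D" and DK: "?D \<subseteq> K" using ps(1,2) uv by auto
  have vs: "vs = sorted_list_of_set ?D"
    using vs_sorted ps(1) uv by (simp add: sorted_list_of_set.idem_if_sorted_distinct)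
  have y: "(?y, val K) \<in> r" "rk ?y = t"
    using val_mono[OF usF K] us rk_val[OF usF] len ps(1) uv distinct_card[of us] by auto
  have "(K - ?D) \<union> set (take i (sorted_list_of_set ?D)) \<in> F" for i
    using ps(3)[of "t + i"] len us vs by (simp add: uv)
  then have "?D = deletion K ?y"
    by (intro deletion_unique[OF K y(1) DK])
      (use deletion_sorted_iff[OF DK K] us in auto)
  moreover have "set (take i us) \<in> F" for i
    using ps(3)[of "min i t"] by (simp add: us_def min_def split: if_splits)
  then have "us \<in> orders_within (K - ?D) T"
    using dus us ps(1) uv by (auto simp: orders_within_def insertion_orders_def)
  ultimately show "ps \<in> ?R"
    using uv vs y by (auto simp: under_def intro!: exI[of _ ?y] imageI)
next
  fix ps assume "ps \<in> ?R"
  then obtain y us where y: "(y, val K) \<in> r" "rk y = t"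
    and us: "us \<in> orders_within (K - deletion K y) T"
    and ps: "ps = us @ sorted_list_of_set (deletion K y)" by (auto simp: under_def)
  note D = deletion[OF K y(1)]
  have fin: "finite (deletion K y)" using D(1) finite_F[OF K] finite_subset by blast
  have us': "distinct us" "set us = K - deletion K y" "\<And>i. set (take i us) \<in> F"
    "descents us \<subseteq> T" using us by (auto simp: orders_within_def insertion_orders_def)
  have len: "length us = t"
    using us'(1,2) y(2) D(3) rk_val[OF D(4)] by (metis distinct_card)
  have "descents ps \<subseteq> insert t T"
    unfolding ps descents_append_subset_iff[OF len assms(1)] using us'(4) by simp
  moreover have "set (take i ps) \<in> F" for i
  proof (cases "i \<le> t")
    case True
    then show ?thesis using us'(3) len ps by simp
  next
    case False
    then have "set (take i ps)
      = (K - deletion K y) \<union> set (take (i - t) (sorted_list_of_set (deletion K y)))"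
      using len us'(2) by (simp add: ps)
    then show ?thesis using deletion_sorted_iff[OF D(1) K] D(2) by simp
  qed
  ultimately show "ps \<in> orders_within K (insert t T)"
    using us'(1,2) D(1) fin by (auto simp: orders_within_def insertion_orders_def ps)
qed

lemma card_orders_within_insert:
  assumes "T \<subseteq> {..<t}" and K: "K \<in> F" and "t \<le> card K"
  shows "card (orders_within K (insert t T))
    = (\<Sum>y \<in> {y \<in> under r (val K). rk y = t}. card (orders_within (K - deletion K y) T))"
proof -
  let ?Y = "{y \<in> under r (val K). rk y = t}"
  let ?f = "\<lambda>y. (\<lambda>ps. ps @ sorted_list_of_set (deletion K y))"
  have fin: "finite ?Y"
    by (rule finite_subset[OF _ finite_Field]) (auto simp: under_def intro: FieldI1)
  have fin_o: "finite (orders_within L T)" for L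
    by (simp add: orders_within_def finite_insertion_orders)
  have start: "val (set (take t (?f y ps))) = y"
    if "y \<in> ?Y" "ps \<in> orders_within (K - deletion K y) T" for y ps
  proof -
    have y: "(y, val K) \<in> r" "rk y = t" using that by (auto simp: under_def)
    have ps: "distinct ps" "set ps = K - deletion K y"
      using that(2) by (auto simp: orders_within_def insertion_orders_def)
    have "length ps = t"
      using ps y(2) deletion(3,4)[OF K y(1)] rk_val by (metis distinct_card)
    then show ?thesis using ps deletion(3)[OF K y(1)] by simp
  qed
  have disj: "?f y ` orders_within (K - deletion K y) T
      \<inter> ?f z ` orders_within (K - deletion K z) T = {}" if "y \<in> ?Y" "z \<in> ?Y" "y \<noteq> z" for y z
  proof (rule equals0I)
    fix ps assume "ps \<in> ?f y ` orders_within (K - deletion K y) T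
      \<inter> ?f z ` orders_within (K - deletion K z) T"
    then obtain us vs where "us \<in> orders_within (K - deletion K y) T" "ps = ?f y us"
      "vs \<in> orders_within (K - deletion K z) T" "ps = ?f z vs" by auto
    then have "val (set (take t ps)) = y" "val (set (take t ps)) = z"
      using start[OF that(1)] start[OF that(2)] by metis+
    then show False using that(3) by simp
  qed
  have "card (orders_within K (insert t T))
    = (\<Sum>y \<in> ?Y. card (?f y ` orders_within (K - deletion K y) T))"
    unfolding orders_within_insert[OF assms]
  proof (rule card_UN_disjoint[OF fin])
    show "\<forall>y \<in> ?Y. finite (?f y ` orders_within (K - deletion K y) T)" using fin_o by blast
    show "\<forall>y \<in> ?Y. \<forall>z \<in> ?Y. y \<noteq> z \<longrightarrow> ?f y ` orders_within (K - deletion K y) T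
      \<inter> ?f z ` orders_within (K - deletion K z) T = {}" using disj by blast
  qed
  also have "\<dots> = (\<Sum>y \<in> ?Y. card (orders_within (K - deletion K y) T))"
    by (rule sum.cong[OF refl], rule card_image) (simp add: inj_on_def)
  finally show ?thesis .
qed

text \<open>
  Without descents there is one order, the unique decreasing chain down to the bottom.
\<close>

lemma orders_within_empty:
  assumes K: "K \<in> F" shows "orders_within K {} = {sorted_list_of_set K}"
proof -
  have fin: "finite K" by (rule finite_F[OF K])
  have "set (take i (sorted_list_of_set K)) \<in> F" for i
    using prefixes_of_sorted_list[OF fin, of "\<lambda>X. X \<in> F"] initial_segment_in[OF K] by blast
  then show ?thesis using fin
    by (auto simp: orders_within_def insertion_orders_def descents_empty_iff
        sorted_list_of_set.idem_if_sorted_distinct)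
qed

text \<open>
  The induction runs over all admissible \<open>K\<close> at once, because below \<open>y\<close> the recursion continues
  with the set of positions that the deletion leaves, and this depends on the chain above \<open>y\<close>.
  The count of chains does not depend on it, which is what makes the recursions agree.
\<close>

lemma card_chains_under_eq_orders:
  assumes "K \<in> F" and "finite T" and "T \<subseteq> {..<card K}"
  shows "card (chains_under (val K) T) = card (orders_within K T)"
  using assms(2,1,3)
proof (induction T arbitrary: K rule: finite_linorder_max_induct)
  case empty
  have "chains_under (val K) {} = {{}}" by (auto simp: chains_under_def Chains_def)
  then show ?case using orders_within_empty[OF empty.prems(1)] by simp
next
  case (insert t T)
  have T: "T \<subseteq> {..<t}" using insert.hyps by auto
  have t: "t \<le> card K" using insert.prems by auto
  have "card (chains_under y T) = card (orders_within (K - deletion K y) T)"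
    if "(y, val K) \<in> r" "rk y = t" for y
    using insert.IH[OF deletion(4)[OF insert.prems(1) that(1)]]
      deletion(3,4)[OF insert.prems(1) that(1)] rk_val T that(2) by metis
  then show ?case
    unfolding card_chains_under_insert[OF T val_Field[OF insert.prems(1)]]
      card_orders_within_insert[OF T insert.prems(1) t]
    by (intro sum.cong) (auto simp: under_def)
qed

lemma flag_f_eq:
  assumes "T \<subseteq> {0<..<n}"
  shows "flag_f r T = card {ps \<in> insertion_orders F {..<n}. descents ps \<subseteq> T}"
proof -
  have "{C \<in> Chains r. C \<subseteq> Field r - {poset_bot r, poset_top r} \<and> elem_rank r ` C = T}
      = chains_under (val {..<n}) T"
  proof (intro equalityI subsetI)
    fix C assume C: "C \<in> {C \<in> Chains r. C \<subseteq> Field r - {poset_bot r, poset_top r} \<and>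
      elem_rank r ` C = T}"
    then have "elem_rank r ` C = rk ` C" using elem_rank_eq by (intro image_cong) auto
    then show "C \<in> chains_under (val {..<n}) T"
      using C Chains_under_full by (auto simp: chains_under_def)
  next
    fix C assume "C \<in> chains_under (val {..<n}) T"
    then have C: "C \<in> Chains r" "rk ` C = T" by (auto simp: chains_under_def)
    note CF = Chains_subset_Field[OF C(1)]
    have "elem_rank r ` C = rk ` C" using elem_rank_eq CF by (intro image_cong) auto
    moreover have "poset_bot r \<notin> C" "poset_top r \<notin> C"
      using C(2) assms rk_val[OF empty_in] rk_val[OF full_in]
      by (force simp: poset_bot_eq poset_top_eq)+
    ultimately show "C \<in> {C \<in> Chains r. C \<subseteq> Field r - {poset_bot r, poset_top r} \<and>
      elem_rank r ` C = T}" using C CF by auto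
  qed
  moreover have "finite T" using assms by (rule finite_subset) simp
  moreover have "T \<subseteq> {..<card {..<n}}" using assms by auto
  ultimately show ?thesis
    unfolding flag_f_def using card_chains_under_eq_orders[OF full_in] by (simp add: orders_within_def)
qed

text \<open>
  The flag f-vector counts the admissible orders by containment of their descent set in \<open>T\<close>,
  so Moebius inversion over the subsets of \<open>S\<close> isolates the orders with descent set exactly \<open>S\<close>.
\<close>

lemma flag_h_eq:
  assumes "S \<subseteq> {0<..<n}"
  shows "flag_h r S = int (card {ps \<in> insertion_orders F {..<n}. descents ps = S})"
proof -
  define A where "A = insertion_orders F {..<n}"
  have finA: "finite A" by (simp add: A_def finite_insertion_orders)
  have finS: "finite S" using assms by (rule finite_subset) simp
  have "int (card {ps \<in> A. descents ps \<subseteq> T})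
      = (\<Sum>U \<in> Pow T. int (card {ps \<in> A. descents ps = U}))" if "finite T" for T
  proof -
    have "{ps \<in> A. descents ps \<subseteq> T} = (\<Union>U \<in> Pow T. {ps \<in> A. descents ps = U})" by auto
    moreover have "card (\<Union>U \<in> Pow T. {ps \<in> A. descents ps = U})
        = (\<Sum>U \<in> Pow T. card {ps \<in> A. descents ps = U})"
    proof (rule card_UN_disjoint)
      show "finite (Pow T)" using that by simp
      show "\<forall>U \<in> Pow T. finite {ps \<in> A. descents ps = U}" using finA by simp
      show "\<forall>U \<in> Pow T. \<forall>V \<in> Pow T. U \<noteq> V \<longrightarrow>
        {ps \<in> A. descents ps = U} \<inter> {ps \<in> A. descents ps = V} = {}" by blast
    qed
    ultimately show ?thesis by simp
  qed
  then have "int (card {ps \<in> A. descents ps = S})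
      = (\<Sum>T \<in> Pow S. (-1) ^ (card S - card T) * int (card {ps \<in> A. descents ps \<subseteq> T}))"
    using finS by (rule inclusion_exclusion_mobius)
  also have "\<dots> = (\<Sum>T \<in> Pow S. (-1) ^ card (S - T) * int (flag_f r T))"
  proof (rule sum.cong[OF refl])
    fix T assume T: "T \<in> Pow S"
    then have "card (S - T) = card S - card T"
      using finite_subset[OF _ finS] by (intro card_Diff_subset) auto
    moreover have "flag_f r T = card {ps \<in> A. descents ps \<subseteq> T}"
      unfolding A_def using T assms by (intro flag_f_eq) auto
    ultimately show "(-1) ^ (card S - card T) * int (card {ps \<in> A. descents ps \<subseteq> T})
      = (-1) ^ card (S - T) * int (flag_f r T)" by simp
  qed
  finally show ?thesis by (simp add: flag_h_def A_def)
qed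

end


section \<open>Subwords given by sets of positions\<close>

lemma nths_split:
  "nths ws K = nths ws (K \<inter> {..<k})
    @ (if k \<in> K \<and> k < length ws then [ws ! k] else []) @ nths ws (K \<inter> {k<..})"
proof (induction ws arbitrary: k K)
  case (Cons a ws)
  show ?case
  proof (cases k)
    case 0
    have "{j. Suc j \<in> K \<inter> {0<..}} = {j. Suc j \<in> K}" by auto
    then show ?thesis using 0 by (simp add: nths_Cons)
  next
    case (Suc k')
    have "{j. Suc j \<in> K \<inter> {..<k}} = {j. Suc j \<in> K} \<inter> {..<k'}"
      "{j. Suc j \<in> K \<inter> {k<..}} = {j. Suc j \<in> K} \<inter> {k'<..}" using Suc by auto
    then show ?thesis
      using Cons.IH[of "{j. Suc j \<in> K}" k'] Suc by (simp add: nths_Cons)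
  qed
qed simp

lemma nths_split_in:
  "k \<in> K \<Longrightarrow> k < length ws \<Longrightarrow>
    nths ws K = nths ws (K \<inter> {..<k}) @ ws ! k # nths ws (K \<inter> {k<..})"
  using nths_split[of ws K k] by simp

lemma nths_split_notin:
  "k \<notin> K \<Longrightarrow> nths ws K = nths ws (K \<inter> {..<k}) @ nths ws (K \<inter> {k<..})"
  using nths_split[of ws K k] by simp

lemma nths_remove1:
  assumes "k \<in> K" "k < length ws"
  shows "nths ws (K - {k}) = nths ws (K \<inter> {..<k}) @ nths ws (K \<inter> {k<..})"
proof -
  have "(K - {k}) \<inter> {..<k} = K \<inter> {..<k}" "(K - {k}) \<inter> {k<..} = K \<inter> {k<..}" by auto
  then show ?thesis using nths_split_notin[of k "K - {k}" ws] by simp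
qed

text \<open>
  Recovers the position of a letter of a subword within the full word.
\<close>

lemma nths_eq_append_ConsE:
  assumes "nths ws K = xs @ y # zs"
  obtains k where "k \<in> K" "k < length ws" "xs = nths ws (K \<inter> {..<k})" "y = ws ! k"
    "zs = nths ws (K \<inter> {k<..})"
proof -
  have "\<exists>k \<in> K. k < length ws \<and> xs = nths ws (K \<inter> {..<k}) \<and> y = ws ! k
      \<and> zs = nths ws (K \<inter> {k<..})"
    using assms
  proof (induction ws arbitrary: K xs)
    case (Cons a ws)
    let ?K = "{j. Suc j \<in> K}"
    show ?case
    proof (cases "0 \<in> K \<and> xs = []")
      case True
      have "{j. Suc j \<in> K \<inter> {0<..}} = ?K" by auto
      then show ?thesis using True Cons.prems by (intro bexI[of _ 0]) (auto simp: nths_Cons)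
    next
      case False
      define xs' where "xs' = (if 0 \<in> K then tl xs else xs)"
      have xs: "xs = (if 0 \<in> K then [a] else []) @ xs'" and "nths ws ?K = xs' @ y # zs"
        using False Cons.prems by (auto simp: xs'_def nths_Cons Cons_eq_append_conv split: if_splits)
      then obtain k where k: "Suc k \<in> K" "k < length ws" "xs' = nths ws (?K \<inter> {..<k})" "y = ws ! k"
        "zs = nths ws (?K \<inter> {k<..})" using Cons.IH by blast
      have "{j. Suc j \<in> K \<inter> {..<Suc k}} = ?K \<inter> {..<k}"
        "{j. Suc j \<in> K \<inter> {Suc k<..}} = ?K \<inter> {k<..}" by auto
      then show ?thesis using k xs by (intro bexI[of _ "Suc k"]) (auto simp: nths_Cons)
    qed
  qed simp
  then show ?thesis using that by blast
qed

lemma subseq_delete: "subseq (us @ vs) (us @ s # vs)"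
  by (induction us) auto

lemma subseq_nths_mono: "L \<subseteq> K \<Longrightarrow> subseq (nths ws L) (nths ws K)"
proof (induction ws arbitrary: L K)
  case (Cons a ws)
  have "subseq (nths ws {j. Suc j \<in> L}) (nths ws {j. Suc j \<in> K})"
    by (rule Cons.IH) (use Cons.prems in auto)
  then show ?case using Cons.prems by (auto simp: nths_Cons)
qed simp

lemma length_nths_subset: "K \<subseteq> {..<length ws} \<Longrightarrow> length (nths ws K) = card K"
  unfolding length_nths by (rule arg_cong[of _ _ card]) auto


section \<open>Reflections and the exchange property\<close>

context coxeter_system
begin

abbreviation wp :: "'a list \<Rightarrow> 'a" where "wp \<equiv> word_prod W"
abbreviation len :: "'a \<Rightarrow> nat" where "len \<equiv> cox_length W S"

definition reduced :: "'a list \<Rightarrow> bool" where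
  "reduced ws \<longleftrightarrow> ws \<in> lists S \<and> length ws = len (wp ws)"

lemma reduced_word_iff: "reduced_word W S w ws \<longleftrightarrow> reduced ws \<and> wp ws = w"
  by (auto simp: reduced_word_def reduced_def)

lemma gen_carrier [simp]: "s \<in> S \<Longrightarrow> s \<in> carrier W"
  using gens_closed by blast

lemma wp_simps [simp]: "wp [] = \<one>" "wp (s # ws) = s \<otimes> wp ws"
  by (simp_all add: word_prod_def)

lemma wp_carrier [simp]: "ws \<in> lists S \<Longrightarrow> wp ws \<in> carrier W"
  by (induction ws) auto

lemma wp_append: "us \<in> lists S \<Longrightarrow> vs \<in> lists S \<Longrightarrow> wp (us @ vs) = wp us \<otimes> wp vs"
  by (induction us) (auto simp: m_assoc)

lemma alternating_in_lists: "s \<in> S \<Longrightarrow> t \<in> S \<Longrightarrow> concat (replicate k [s, t]) \<in> lists S"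
  by (auto simp: in_lists_conv_set)

lemma wp_relator:
  assumes "s \<in> S" "t \<in> S" "m s t = enat k"
  shows "wp (concat (replicate k [s, t])) = \<one>"
proof -
  have "coxeter_step S m ([] @ []) ([] @ concat (replicate k [s, t]) @ [])"
    by (rule coxeter_step.intros) (use assms in auto)
  then have "equivclp (coxeter_step S m) [] (concat (replicate k [s, t]))" by auto
  moreover have "concat (replicate k [s, t]) \<in> lists S" using assms by (intro alternating_in_lists)
  ultimately show ?thesis using presentation[of "[]" "concat (replicate k [s, t])"] by simp
qed

lemma gen_sq [simp]: "s \<in> S \<Longrightarrow> s \<otimes> s = \<one>"
  using wp_relator[of s s 1] matrix_diag[of s] by (simp add: one_enat_def)

lemma gen_cancel [simp]: "s \<in> S \<Longrightarrow> x \<in> carrier W \<Longrightarrow> s \<otimes> (s \<otimes> x) = x"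
  by (simp flip: m_assoc)

lemma inv_cancel [simp]:
  "g \<in> carrier W \<Longrightarrow> x \<in> carrier W \<Longrightarrow> inv g \<otimes> (g \<otimes> x) = x"
  "g \<in> carrier W \<Longrightarrow> x \<in> carrier W \<Longrightarrow> g \<otimes> (inv g \<otimes> x) = x"
  by (simp_all flip: m_assoc)

lemma inv_gen [simp]: "s \<in> S \<Longrightarrow> inv s = s"
  by (rule inv_equality) auto

lemma wp_rev: "ws \<in> lists S \<Longrightarrow> wp (rev ws) = inv (wp ws)"
proof (induction ws)
  case (Cons s ws)
  then have "s \<in> S" "ws \<in> lists S" "rev ws \<in> lists S" by auto
  then show ?case using Cons.IH wp_append[of "rev ws" "[s]"] by (simp add: inv_mult_group)
qed simp

lemma ex_word:
  assumes "g \<in> carrier W" shows "\<exists>ws \<in> lists S. wp ws = g"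
proof -
  have "g \<in> generate W S" using assms gens_generate by simp
  then show ?thesis
  proof induction
    case one
    show ?case by (rule bexI[of _ "[]"]) auto
  next
    case (incl s)
    then show ?case by (intro bexI[of _ "[s]"]) auto
  next
    case (inv s)
    then show ?case by (intro bexI[of _ "[s]"]) auto
  next
    case (eng g h)
    then obtain us vs where "us \<in> lists S" "wp us = g" "vs \<in> lists S" "wp vs = h" by blast
    then show ?case by (intro bexI[of _ "us @ vs"]) (auto simp: wp_append)
  qed
qed

lemma len_le: "ws \<in> lists S \<Longrightarrow> len (wp ws) \<le> length ws"
  unfolding cox_length_def by (rule Least_le) blast

lemma ex_reduced: assumes "g \<in> carrier W" obtains ws where "reduced ws" "wp ws = g"
proof -
  have "\<exists>k. \<exists>ws \<in> lists S. wp ws = g \<and> length ws = k" using ex_word[OF assms] by blast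
  then have "\<exists>ws \<in> lists S. wp ws = g \<and> length ws = len g"
    unfolding cox_length_def by (rule LeastI_ex)
  then show ?thesis using that by (auto simp: reduced_def)
qed

lemma reducedD: "reduced ws \<Longrightarrow> ws \<in> lists S" "reduced ws \<Longrightarrow> len (wp ws) = length ws"
  by (auto simp: reduced_def)

lemma reducedI: "ws \<in> lists S \<Longrightarrow> length ws \<le> len (wp ws) \<Longrightarrow> reduced ws"
  using len_le[of ws] by (simp add: reduced_def)

lemma len_mult_le:
  assumes "g \<in> carrier W" "h \<in> carrier W" shows "len (g \<otimes> h) \<le> len g + len h"
proof -
  obtain us vs where "reduced us" "wp us = g" "reduced vs" "wp vs = h"
    using ex_reduced assms by metis
  then show ?thesis using len_le[of "us @ vs"] by (auto simp: wp_append reduced_def)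
qed

lemma reduced_appendD:
  assumes "reduced (us @ vs)" shows "reduced us" "reduced vs"
proof -
  have S: "us \<in> lists S" "vs \<in> lists S" using reducedD(1)[OF assms] by auto
  have "length us + length vs \<le> len (wp us) + len (wp vs)"
    using reducedD(2)[OF assms] len_mult_le[of "wp us" "wp vs"] S by (simp add: wp_append)
  then show "reduced us" "reduced vs"
    using len_le[OF S(1)] len_le[OF S(2)] S by (auto intro!: reducedI)
qed

lemma reduced_ConsD: "reduced (s # ws) \<Longrightarrow> reduced ws"
  using reduced_appendD(2)[of "[s]" ws] by simp

lemma len_gen_mult_le: "s \<in> S \<Longrightarrow> g \<in> carrier W \<Longrightarrow> len (s \<otimes> g) \<le> Suc (len g)"
  using len_mult_le[of s g] len_le[of "[s]"] by simp

lemma len_gen_mult_ge: "s \<in> S \<Longrightarrow> g \<in> carrier W \<Longrightarrow> len g \<le> Suc (len (s \<otimes> g))"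
  using len_gen_mult_le[of s "s \<otimes> g"] by simp

text \<open>
  The number of \<open>i\<close> for which \<open>t = s\<^sub>1 \<cdots> s\<^sub>i \<cdots> s\<^sub>1\<close>, where the word is \<open>s\<^sub>1 s\<^sub>2 \<cdots>\<close>. Only its parity
  is an invariant of the group element.
\<close>

primrec reflection_count :: "'a list \<Rightarrow> 'a \<Rightarrow> nat" where
  "reflection_count [] t = 0"
| "reflection_count (s # ws) t = of_bool (t = s) + reflection_count ws (s \<otimes> t \<otimes> s)"

lemma reflection_count_append:
  assumes "us \<in> lists S" "vs \<in> lists S" "t \<in> carrier W"
  shows "reflection_count (us @ vs) t
    = reflection_count us t + reflection_count vs (inv (wp us) \<otimes> t \<otimes> wp us)"
  using assms
proof (induction us arbitrary: t)
  case (Cons s us)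
  then have "s \<in> S" "us \<in> lists S" by auto
  then show ?case using Cons.IH[of "s \<otimes> t \<otimes> s"] Cons.prems by (simp add: inv_mult_group m_assoc)
qed simp

lemma reflection_count_alternating:
  assumes st: "s \<in> S" "t \<in> S" and x: "x \<in> carrier W"
  shows "reflection_count (concat (replicate n [s, t])) x
    = (\<Sum>i<2 * n. of_bool (x = (s \<otimes> t) [^] i \<otimes> s))"
  using x
proof (induction n arbitrary: x)
  case (Suc n)
  define f :: "nat \<Rightarrow> nat" where "f i = of_bool (x = (s \<otimes> t) [^] i \<otimes> s)" for i
  have shift: "(t \<otimes> (s \<otimes> x \<otimes> s) \<otimes> t = (s \<otimes> t) [^] i \<otimes> s) \<longleftrightarrow> (x = (s \<otimes> t) [^] (Suc (Suc i)) \<otimes> s)"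
    for i :: nat
  proof -
    let ?p = "(s \<otimes> t) [^] i"
    have p: "?p \<in> carrier W" using st by simp
    have *: "(s \<otimes> t) [^] (Suc (Suc i)) = s \<otimes> t \<otimes> ?p \<otimes> (s \<otimes> t)"
      using st by (metis (no_types, lifting) gen_carrier m_closed nat_pow_Suc nat_pow_Suc2)
    show ?thesis
    proof
      assume "t \<otimes> (s \<otimes> x \<otimes> s) \<otimes> t = ?p \<otimes> s"
      then have "s \<otimes> t \<otimes> (t \<otimes> (s \<otimes> x \<otimes> s) \<otimes> t) \<otimes> t \<otimes> s = s \<otimes> t \<otimes> (?p \<otimes> s) \<otimes> t \<otimes> s" by simp
      then show "x = (s \<otimes> t) [^] (Suc (Suc i)) \<otimes> s"
        unfolding * using st p Suc.prems by (simp add: m_assoc)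
    next
      assume "x = (s \<otimes> t) [^] (Suc (Suc i)) \<otimes> s"
      then show "t \<otimes> (s \<otimes> x \<otimes> s) \<otimes> t = ?p \<otimes> s"
        unfolding * using st p by (simp add: m_assoc)
    qed
  qed
  have "s \<otimes> x \<otimes> s = t \<longleftrightarrow> x = s \<otimes> t \<otimes> s"
  proof
    assume "s \<otimes> x \<otimes> s = t"
    then have "s \<otimes> (s \<otimes> x \<otimes> s) \<otimes> s = s \<otimes> t \<otimes> s" by simp
    then show "x = s \<otimes> t \<otimes> s" using st Suc.prems by (simp add: m_assoc)
  qed (use st in \<open>simp add: m_assoc\<close>)
  then have "reflection_count (concat (replicate (Suc n) [s, t])) x
    = f 0 + (f 1 + reflection_count (concat (replicate n [s, t])) (t \<otimes> (s \<otimes> x \<otimes> s) \<otimes> t))"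
    using st Suc.prems by (simp add: f_def)
  also have "reflection_count (concat (replicate n [s, t])) (t \<otimes> (s \<otimes> x \<otimes> s) \<otimes> t)
    = (\<Sum>i<2 * n. f (Suc (Suc i)))"
    unfolding f_def shift[symmetric] using Suc.IH st Suc.prems by (simp del: sum_of_bool_eq)
  also have "f 0 + (f 1 + (\<Sum>i<2 * n. f (Suc (Suc i)))) = (\<Sum>i<Suc (Suc (2 * n)). f i)"
    by (simp add: sum.lessThan_Suc_shift del: sum.lessThan_Suc)
  finally show ?case by (simp add: f_def del: sum_of_bool_eq sum.lessThan_Suc nat_pow_Suc)
qed simp

text \<open>
  The inversions of \<open>(st)\<^sup>k\<close> are \<open>(st)\<^sup>i s\<close> for \<open>i < 2k\<close>, and since \<open>(st)\<^sup>k = 1\<close> the second half of this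
  list repeats the first.
\<close>

lemma even_reflection_count_relator:
  assumes st: "s \<in> S" "t \<in> S" and k: "m s t = enat k" and x: "x \<in> carrier W"
  shows "even (reflection_count (concat (replicate k [s, t])) x)"
proof -
  define f :: "nat \<Rightarrow> nat" where "f i = of_bool (x = (s \<otimes> t) [^] i \<otimes> s)" for i
  have "wp (concat (replicate j [s, t])) = (s \<otimes> t) [^] j" for j :: nat
  proof (induction j)
    case (Suc j)
    have "(s \<otimes> t) [^] Suc j = (s \<otimes> t) \<otimes> (s \<otimes> t) [^] j" using st by (intro nat_pow_Suc2) simp
    then show ?case using Suc st by (simp add: m_assoc)
  qed simp
  then have one: "(s \<otimes> t) [^] k = \<one>" using wp_relator[OF st k] by simp
  have "(s \<otimes> t) [^] (k + i) = (s \<otimes> t) [^] i" for i :: nat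
    using st one nat_pow_mult[of "s \<otimes> t" k i] by simp
  then have periodic: "f (k + i) = f i" for i by (simp add: f_def)
  have "(\<Sum>i<k + j. f i) = (\<Sum>i<k. f i) + (\<Sum>i<j. f (k + i))" for j by (induction j) simp_all
  then have "(\<Sum>i<2 * k. f i) = 2 * (\<Sum>i<k. f i)" unfolding mult_2 by (simp add: periodic)
  then show ?thesis
    unfolding reflection_count_alternating[OF st x] f_def[symmetric] by simp
qed

lemma reflection_count_parity:
  assumes "us \<in> lists S" "vs \<in> lists S" "wp us = wp vs" "x \<in> carrier W"
  shows "even (reflection_count us x) \<longleftrightarrow> even (reflection_count vs x)"
proof -
  have relator: "even (reflection_count us x) \<longleftrightarrow> even (reflection_count vs x)"
    if "coxeter_step S m us vs" for us vs
    using that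
  proof cases
    case (1 us' vs' s t k)
    let ?R = "concat (replicate k [s, t])"
    have R: "?R \<in> lists S" using 1 by (intro alternating_in_lists)
    have "wp ?R = \<one>" using wp_relator 1 by simp
    then show ?thesis
      using 1 R assms(4) even_reflection_count_relator[OF 1(5,6,7), of "inv (wp us') \<otimes> x \<otimes> wp us'"]
      by (simp add: reflection_count_append)
  qed
  have "equivclp (coxeter_step S m) us vs" using presentation assms by blast
  then show ?thesis
  proof induction
    case (step vs vs')
    then show ?case using relator[of vs vs'] relator[of vs' vs] by blast
  qed simp
qed

definition reflections :: "'a set" where
  "reflections = {g \<otimes> s \<otimes> inv g |g s. g \<in> carrier W \<and> s \<in> S}"

lemma reflectionE:
  assumes "t \<in> reflections"
  obtains g s where "t = g \<otimes> s \<otimes> inv g" "g \<in> carrier W" "s \<in> S"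
  using assms by (auto simp: reflections_def)

lemma reflection_carrier [simp]: "t \<in> reflections \<Longrightarrow> t \<in> carrier W"
  by (auto elim: reflectionE)

lemma gen_reflection [simp]: "s \<in> S \<Longrightarrow> s \<in> reflections"
  unfolding reflections_def by (rule CollectI, rule exI[of _ "\<one>"], rule exI[of _ s]) simp

lemma reflection_sq [simp]: "t \<in> reflections \<Longrightarrow> t \<otimes> t = \<one>"
proof -
  assume "t \<in> reflections"
  then obtain g s where "t = g \<otimes> s \<otimes> inv g" "g \<in> carrier W" "s \<in> S" by (rule reflectionE)
  then show ?thesis by (simp add: m_assoc)
qed

lemma reflection_cancel [simp]:
  "t \<in> reflections \<Longrightarrow> x \<in> carrier W \<Longrightarrow> t \<otimes> (t \<otimes> x) = x"
  by (simp flip: m_assoc)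

lemma reflection_conj:
  assumes "t \<in> reflections" "s \<in> S" shows "s \<otimes> t \<otimes> s \<in> reflections"
proof -
  obtain g r where "t = g \<otimes> r \<otimes> inv g" "g \<in> carrier W" "r \<in> S"
    using assms(1) by (rule reflectionE)
  then have "s \<otimes> t \<otimes> s = (s \<otimes> g) \<otimes> r \<otimes> inv (s \<otimes> g)" "s \<otimes> g \<in> carrier W"
    using assms(2) by (simp_all add: m_assoc inv_mult_group)
  then show ?thesis using \<open>r \<in> S\<close> unfolding reflections_def by blast
qed

text \<open>
  A palindromic word \<open>g s g\<inverse>\<close> of the reflection \<open>t\<close> contains \<open>t\<close> an odd number of times: the
  contributions of \<open>g\<close> and \<open>g\<inverse>\<close> have the same parity since \<open>g g\<inverse> = 1\<close>, and the middle letter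
  adds one. Prefixing this word to a word of \<open>x\<close> gives a word of \<open>t x\<close>, and it leaves \<open>t\<close> fixed under
  conjugation, so the parity flips.
\<close>

lemma reflection_count_mult:
  assumes t: "t \<in> reflections" and us: "us \<in> lists S" and vs: "vs \<in> lists S"
    and eq: "wp vs = t \<otimes> wp us"
  shows "odd (reflection_count vs t) \<longleftrightarrow> even (reflection_count us t)"
proof -
  obtain g s where gs: "t = g \<otimes> s \<otimes> inv g" "g \<in> carrier W" "s \<in> S"
    using t by (rule reflectionE)
  obtain gw where gw: "gw \<in> lists S" "wp gw = g" using ex_word gs(2) by blast
  let ?tw = "gw @ s # rev gw"
  have rgw: "rev gw \<in> lists S" using gw(1) by auto
  have tw: "?tw \<in> lists S" using gw rgw gs by auto
  have wtw: "wp ?tw = t" using gw rgw gs by (simp add: wp_append wp_rev m_assoc)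
  have conj: "inv g \<otimes> t \<otimes> g = s" using gs by (simp add: m_assoc)
  have "even (reflection_count (gw @ rev gw) t)"
    using reflection_count_parity[of "gw @ rev gw" "[]" t] gw rgw t r_inv[OF gs(2)] by (simp add: wp_append wp_rev)
  then have "odd (reflection_count ?tw t)"
    using gw rgw gs(3) t conj by (simp add: reflection_count_append)
  moreover have "reflection_count (?tw @ us) t = reflection_count ?tw t + reflection_count us t"
    using reflection_count_append[OF tw us, of t] t wtw by (simp add: m_assoc)
  moreover have "even (reflection_count vs t) \<longleftrightarrow> even (reflection_count (?tw @ us) t)"
  proof (rule reflection_count_parity)
    show "?tw @ us \<in> lists S" using tw us by (simp only: append_in_lists_conv)
    show "wp vs = wp (?tw @ us)" using wp_append[OF tw us] wtw eq by (simp only:)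
  qed (use vs t in auto)
  ultimately show ?thesis by simp
qed

lemma reflection_count_pos:
  assumes "ws \<in> lists S" "t \<in> carrier W" "0 < reflection_count ws t"
  shows "\<exists>us s vs. ws = us @ s # vs \<and> t = wp us \<otimes> s \<otimes> inv (wp us)"
  using assms
proof (induction ws arbitrary: t)
  case (Cons s ws)
  have s: "s \<in> S" and ws: "ws \<in> lists S" using Cons.hyps by auto
  show ?case
  proof (cases "t = s")
    case True
    then have "s # ws = [] @ s # ws \<and> t = wp [] \<otimes> s \<otimes> inv (wp [])" using s by simp
    then show ?thesis by blast
  next
    case False
    then have "0 < reflection_count ws (s \<otimes> t \<otimes> s)" using Cons.prems by simp
    then obtain us r vs where *: "ws = us @ r # vs" "s \<otimes> t \<otimes> s = wp us \<otimes> r \<otimes> inv (wp us)"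
      using Cons.IH[of "s \<otimes> t \<otimes> s"] s Cons.prems by auto
    have us: "us \<in> lists S" "r \<in> S" using ws * by auto
    have "t = s \<otimes> (s \<otimes> t \<otimes> s) \<otimes> s" using s Cons.prems by (simp add: m_assoc)
    also have "\<dots> = wp (s # us) \<otimes> r \<otimes> inv (wp (s # us))"
      unfolding *(2) using s us by (simp add: m_assoc inv_mult_group)
    finally have "s # ws = (s # us) @ r # vs \<and> t = wp (s # us) \<otimes> r \<otimes> inv (wp (s # us))"
      using * by simp
    then show ?thesis by blast
  qed
qed simp

lemma delete_letter:
  assumes "us @ s # vs \<in> lists S"
  shows "(wp us \<otimes> s \<otimes> inv (wp us)) \<otimes> wp (us @ s # vs) = wp (us @ vs)"
    and "wp us \<otimes> s \<otimes> inv (wp us) \<in> reflections"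
proof -
  have S: "us \<in> lists S" "vs \<in> lists S" "s \<in> S" using assms by auto
  show "(wp us \<otimes> s \<otimes> inv (wp us)) \<otimes> wp (us @ s # vs) = wp (us @ vs)"
    using S by (simp add: wp_append m_assoc)
  show "wp us \<otimes> s \<otimes> inv (wp us) \<in> reflections" 
    using S(3) wp_carrier[OF S(1)] unfolding reflections_def by blast
qed

lemma len_decreases_if_odd:
  assumes "reduced ws" "t \<in> reflections" "odd (reflection_count ws t)"
  shows "len (t \<otimes> wp ws) < len (wp ws)"
proof -
  obtain us s vs where ws: "ws = us @ s # vs" "t = wp us \<otimes> s \<otimes> inv (wp us)"
    using reflection_count_pos[OF reducedD(1)[OF assms(1)] _ odd_pos[OF assms(3)]] assms(2) by auto
  have "t \<otimes> wp ws = wp (us @ vs)"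
    using delete_letter(1)[of us s vs] ws reducedD(1)[OF assms(1)] by simp
  moreover have "us @ vs \<in> lists S" using ws reducedD(1)[OF assms(1)] by auto
  then have "len (wp (us @ vs)) \<le> length (us @ vs)" by (rule len_le)
  ultimately show ?thesis using ws(1) reducedD(2)[OF assms(1)] by simp
qed

text \<open>
  An odd count at \<open>t\<close> makes a letter deletable, hence lowers the length. The count is odd for exactly
  one of \<open>x\<close> and \<open>t x\<close>, so the converse holds and the two lengths are never equal.
\<close>

lemma len_reflection_iff:
  assumes t: "t \<in> reflections" and ws: "ws \<in> lists S"
  shows "len (t \<otimes> wp ws) < len (wp ws) \<longleftrightarrow> odd (reflection_count ws t)"
    and "len (t \<otimes> wp ws) \<noteq> len (wp ws)"
proof -
  obtain us where us: "reduced us" "wp us = wp ws" using ex_reduced[OF wp_carrier[OF ws]] .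
  obtain vs where vs: "reduced vs" "wp vs = t \<otimes> wp ws"
    using ex_reduced[of "t \<otimes> wp ws"] t ws by auto
  have par: "even (reflection_count us t) \<longleftrightarrow> even (reflection_count ws t)"
    using us ws t reducedD(1) by (intro reflection_count_parity) auto
  have flip: "odd (reflection_count vs t) \<longleftrightarrow> even (reflection_count ws t)"
    using t ws vs reducedD(1) by (intro reflection_count_mult) auto
  show "len (t \<otimes> wp ws) < len (wp ws) \<longleftrightarrow> odd (reflection_count ws t)"
    and "len (t \<otimes> wp ws) \<noteq> len (wp ws)"
    using len_decreases_if_odd[OF us(1) t] len_decreases_if_odd[OF vs(1) t] us(2) vs(2) par flip t ws
    by (cases "odd (reflection_count ws t)"; simp)+
qed

lemma len_reflection_neq:
  "t \<in> reflections \<Longrightarrow> g \<in> carrier W \<Longrightarrow> len (t \<otimes> g) \<noteq> len g"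
  using len_reflection_iff(2) ex_word by metis

lemma strong_exchange:
  assumes "t \<in> reflections" "ws \<in> lists S" "len (t \<otimes> wp ws) < len (wp ws)"
  obtains us s vs where "ws = us @ s # vs" "t = wp us \<otimes> s \<otimes> inv (wp us)"
    "t \<otimes> wp ws = wp (us @ vs)"
proof -
  have "0 < reflection_count ws t" using len_reflection_iff(1) assms odd_pos by blast
  then obtain us s vs where "ws = us @ s # vs" "t = wp us \<otimes> s \<otimes> inv (wp us)"
    using reflection_count_pos[of ws t] assms by auto
  then show ?thesis using that delete_letter(1) assms(2) by blast
qed

lemma deletion_property:
  "ws \<in> lists S \<Longrightarrow> \<exists>vs. subseq vs ws \<and> reduced vs \<and> wp vs = wp ws"
proof (induction ws)
  case Nil
  have "reduced []" using len_le[of "[]"] by (intro reducedI) auto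
  then show ?case by auto
next
  case (Cons s ws)
  have s: "s \<in> S" using Cons.prems by auto
  obtain vs where vs: "subseq vs ws" "reduced vs" "wp vs = wp ws" using Cons by auto
  note vS = reducedD(1)[OF vs(2)]
  show ?case
  proof (cases "reduced (s # vs)")
    case True
    then show ?thesis using vs by (intro exI[of _ "s # vs"]) auto
  next
    case False
    then have "\<not> length (s # vs) \<le> len (s \<otimes> wp vs)"
      using reducedI[of "s # vs"] s vS by auto
    then have "len (s \<otimes> wp vs) < len (wp vs)"
      using len_reflection_neq[of s "wp vs"] s vS reducedD(2)[OF vs(2)] by simp
    then obtain us r vs' where e: "vs = us @ r # vs'" "s \<otimes> wp vs = wp (us @ vs')"
      using strong_exchange[of s vs] s vS by (metis gen_reflection)
    have uS: "us @ vs' \<in> lists S" using e vS by auto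
    have "length (us @ vs') \<le> len (wp (us @ vs'))"
      using len_gen_mult_ge[of s "wp vs"] s vS reducedD(2)[OF vs(2)] e by simp
    then have "reduced (us @ vs')" using uS by (intro reducedI)
    moreover have "subseq (us @ vs') vs" unfolding e by (rule subseq_delete)
    ultimately show ?thesis using vs e
      by (intro exI[of _ "us @ vs'"]) (auto intro: subseq_order.order_trans)
  qed
qed


section \<open>The Bruhat order\<close>

text \<open>
  Left multiplication by reflections that lowers the length generates an order which visibly does
  not depend on a choice of words. It is shown to be the subword order, so the latter is transitive
  and can be tested on any reduced word.
\<close>

definition reflection_step :: "'a \<Rightarrow> 'a \<Rightarrow> bool" where
  "reflection_step x y \<longleftrightarrow> y \<in> carrier W \<and> (\<exists>t \<in> reflections. x = t \<otimes> y \<and> len x < len y)"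

abbreviation bruhat_le :: "'a \<Rightarrow> 'a \<Rightarrow> bool" (infix "\<preceq>" 50) where
  "x \<preceq> y \<equiv> reflection_step\<^sup>*\<^sup>* x y"

lemma bruhat_le_carrier1: "x \<preceq> y \<Longrightarrow> y \<in> carrier W \<Longrightarrow> x \<in> carrier W"
  by (induction rule: converse_rtranclp_induct) (auto simp: reflection_step_def)

lemma gen_step: "s \<in> S \<Longrightarrow> y \<in> carrier W \<Longrightarrow> len y < len (s \<otimes> y) \<Longrightarrow> reflection_step y (s \<otimes> y)"
  unfolding reflection_step_def by (auto intro!: bexI[of _ s])

text \<open>
  Suppose that multiplying by \<open>s\<close> reverses the inequality. Then \<open>s\<close> shortens \<open>y\<close>, so \<open>y\<close> has a
  reduced word beginning with \<open>s\<close>. The reflection \<open>t\<close> deletes a letter of it: deleting \<open>s\<close> gives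
  \<open>s x = y\<close>, and deleting a later letter would make \<open>s x\<close> shorter than \<open>s y\<close> after all.
\<close>

lemma reflection_step_gen_mult:
  assumes xy: "reflection_step x y" and s: "s \<in> S"
  shows "reflection_step (s \<otimes> x) (s \<otimes> y) \<or> s \<otimes> x = y"
proof (rule disjCI)
  assume ne: "s \<otimes> x \<noteq> y"
  obtain t where t: "t \<in> reflections" "x = t \<otimes> y" "len x < len y" and y: "y \<in> carrier W"
    using xy by (auto simp: reflection_step_def)
  have x: "x \<in> carrier W" using t y by simp
  have conj: "s \<otimes> x = (s \<otimes> t \<otimes> s) \<otimes> (s \<otimes> y)" using t s y by (simp add: m_assoc)
  have "len (s \<otimes> x) < len (s \<otimes> y)"
  proof (rule ccontr)
    assume nless: "\<not> ?thesis"
    have "len (s \<otimes> x) \<le> len y" using len_gen_mult_le[OF s x] t(3) by simp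
    then have sy: "len (s \<otimes> y) < len y" using nless len_reflection_neq[of s y] s y by simp
    obtain ys where ys: "reduced ys" "wp ys = s \<otimes> y" using ex_reduced[of "s \<otimes> y"] s y by auto
    note yS = reducedD(1)[OF ys(1)]
    have wy: "wp (s # ys) = y" and sys: "s # ys \<in> lists S" using ys s y yS by auto
    obtain us r vs where e: "s # ys = us @ r # vs" "t = wp us \<otimes> r \<otimes> inv (wp us)"
      "t \<otimes> y = wp (us @ vs)"
      using strong_exchange[OF t(1) sys] wy t(2,3) by metis
    show False
    proof (cases us)
      case Nil
      then have "t = s" using e s by simp
      then show False using ne t s y by simp
    next
      case (Cons r' us')
      then have e': "r' = s" "ys = us' @ r # vs" using e(1) by auto
      have S: "us' @ vs \<in> lists S" using e' yS by auto
      have "s \<otimes> x = wp (us' @ vs)" using t(2) e(3) Cons e' s S by simp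
      then have "len (s \<otimes> x) < length ys" using len_le[OF S] e' by simp
      then show False using nless reducedD(2)[OF ys(1)] ys(2) by simp
    qed
  qed
  then show "reflection_step (s \<otimes> x) (s \<otimes> y)"
    unfolding reflection_step_def using conj reflection_conj[OF t(1) s] s y by auto
qed

text \<open>
  Weak lifting: along a chain, \<open>s\<close> is carried from each element to the next until a step is of
  the form \<open>y = s x\<close>, from where on the chain itself can be followed.
\<close>

lemma bruhat_le_gen_mult:
  assumes "x \<preceq> y" "s \<in> S" "x \<in> carrier W"
  shows "s \<otimes> x \<preceq> y \<or> s \<otimes> x \<preceq> s \<otimes> y"
  using assms(1)
proof induction
  case (step y z)
  show ?case
  proof (cases "s \<otimes> x \<preceq> y")
    case True
    then show ?thesis using step by (auto intro: rtranclp.rtrancl_into_rtrancl)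
  next
    case False
    then have "s \<otimes> x \<preceq> s \<otimes> y" using step by simp
    then show ?thesis
      using reflection_step_gen_mult[OF step(2) assms(2)]
      by (metis rtranclp.rtrancl_into_rtrancl)
  qed
qed simp

lemma lists_subseq: "subseq vs ws \<Longrightarrow> ws \<in> lists S \<Longrightarrow> vs \<in> lists S"
  by (induction rule: list_emb.induct) auto

lemma subword_le:
  assumes "reduced ws" "subseq vs ws" shows "wp vs \<preceq> wp ws"
  using assms
proof (induction ws arbitrary: vs)
  case (Cons s ws)
  have red: "reduced ws" using reduced_ConsD Cons.prems by blast
  have s: "s \<in> S" and ws: "ws \<in> lists S" using reducedD(1)[OF Cons.prems(1)] by auto
  have "len (wp ws) < len (s \<otimes> wp ws)" using reducedD(2) red Cons.prems(1) by fastforce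
  then have up: "wp ws \<preceq> wp (s # ws)" using gen_step[OF s wp_carrier[OF ws]] by auto
  show ?case
  proof (cases "subseq vs ws")
    case True
    then show ?thesis using Cons.IH[OF red] up by (meson rtranclp_trans)
  next
    case False
    then obtain vs' where vs: "vs = s # vs'" "subseq vs' ws"
      using Cons.prems(2) by (auto elim: list_emb.cases)
    have "vs' \<in> lists S" by (rule lists_subseq[OF vs(2) ws])
    then have "s \<otimes> wp vs' \<preceq> wp ws \<or> s \<otimes> wp vs' \<preceq> s \<otimes> wp ws"
      using bruhat_le_gen_mult[OF Cons.IH[OF red vs(2)] s] by simp
    then have "s \<otimes> wp vs' \<preceq> wp (s # ws)" using rtranclp_trans[OF _ up] by auto
    then show ?thesis using vs(1) by simp
  qed
qed (auto dest: list_emb_Nil2)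

lemma subword_if_le:
  assumes "x \<preceq> y" "ws \<in> lists S" "wp ws = y"
  shows "\<exists>vs. subseq vs ws \<and> wp vs = x"
  using assms
proof (induction arbitrary: ws rule: rtranclp_induct)
  case (step y z)
  obtain t where t: "t \<in> reflections" "y = t \<otimes> wp ws" "len y < len (wp ws)"
    using step by (auto simp: reflection_step_def)
  obtain us s vs where e: "ws = us @ s # vs" "y = wp (us @ vs)"
    using strong_exchange[OF t(1) step.prems(1)] t by metis
  have "us @ vs \<in> lists S" using e step.prems(1) by auto
  then obtain xs where xs: "subseq xs (us @ vs)" "wp xs = x" using step.IH e by metis
  have "subseq (us @ vs) ws" unfolding e by (rule subseq_delete)
  then have "subseq xs ws" using xs(1) subseq_order.trans by blast
  then show ?case using xs(2) by blast
qed auto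

lemma bruhat_iff: "(v, w) \<in> bruhat W S \<longleftrightarrow> w \<in> carrier W \<and> v \<preceq> w"
proof
  assume "(v, w) \<in> bruhat W S"
  then obtain ws vs where "reduced ws" "wp ws = w" "subseq vs ws" "wp vs = v"
    by (auto simp: bruhat_def reduced_word_iff)
  then show "w \<in> carrier W \<and> v \<preceq> w" using subword_le reducedD(1) by auto
next
  assume vw: "w \<in> carrier W \<and> v \<preceq> w"
  obtain ws where ws: "reduced ws" "wp ws = w" using ex_reduced vw by blast
  obtain us where us: "subseq us ws" "wp us = v"
    using subword_if_le vw ws reducedD(1) by blast
  then obtain vs where "subseq vs us" "reduced vs" "wp vs = v"
    using deletion_property lists_subseq ws(1) reducedD(1) by metis
  then show "(v, w) \<in> bruhat W S"
    using ws subseq_order.trans[OF _ us(1)] by (auto simp: bruhat_def reduced_word_iff)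
qed

lemma one_le: assumes "x \<in> carrier W" shows "\<one> \<preceq> x"
proof -
  obtain ws where ws: "reduced ws" "wp ws = x" by (rule ex_reduced[OF assms])
  then show ?thesis using subword_le[OF ws(1), of "[]"] by simp
qed

text \<open>
  Induction on the word \<open>s # ws\<close>. If \<open>u\<close> is a subword of \<open>ws\<close>, delete \<open>s\<close>. Otherwise \<open>s u\<close> is one,
  and the induction gives a letter of \<open>ws\<close> to delete, with result \<open>x\<close> above \<open>s u\<close>. If \<open>s\<close> lengthens
  \<open>x\<close>, that letter can be deleted with \<open>s\<close> kept. If not, then \<open>u\<close> is below \<open>x\<close> by lifting, hence
  below \<open>ws\<close>, and \<open>s\<close> can be deleted.
\<close>

lemma reduced_coatom:
  assumes "reduced ws" "u \<preceq> wp ws" "u \<noteq> wp ws"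
  shows "\<exists>us s vs. ws = us @ s # vs \<and> reduced (us @ vs) \<and> u \<preceq> wp (us @ vs)"
  using assms
proof (induction ws arbitrary: u)
  case Nil
  then have "\<exists>vs. subseq vs [] \<and> wp vs = u" by (intro subword_if_le[of u "\<one>" "[]"]) simp_all
  then show ?case using Nil.prems(3) by (auto dest: list_emb_Nil2)
next
  case (Cons s ws)
  have red: "reduced ws" using reduced_ConsD Cons.prems by blast
  have s: "s \<in> S" and ws: "ws \<in> lists S" using reducedD(1)[OF Cons.prems(1)] by auto
  have del_first: ?case if "u \<preceq> wp ws"
    using that red by (intro exI[of _ "[]"] exI[of _ s] exI[of _ ws]) simp
  obtain xs where xs: "subseq xs (s # ws)" "wp xs = u"
    using subword_if_le Cons.prems(2) reducedD(1)[OF Cons.prems(1)] by blast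
  show ?case
  proof (cases "subseq xs ws")
    case True
    then have "u \<preceq> wp ws" using subword_le[OF red] xs(2) by blast
    then show ?thesis by (rule del_first)
  next
    case False
    then obtain xs' where x: "xs = s # xs'" "subseq xs' ws"
      using xs(1) by (auto elim: list_emb.cases)
    have xS: "xs' \<in> lists S" using lists_subseq[OF x(2) ws] .
    have u: "u = s \<otimes> wp xs'" using xs x by simp
    have "wp xs' \<noteq> wp ws" using u Cons.prems(3) by auto
    then obtain us r vs where IH: "ws = us @ r # vs" "reduced (us @ vs)" "wp xs' \<preceq> wp (us @ vs)"
      using Cons.IH[OF red subword_le[OF red x(2)]] by blast
    let ?x = "wp (us @ vs)"
    have S: "us @ vs \<in> lists S" using reducedD(1)[OF IH(2)] .
    have ux: "u \<preceq> ?x \<or> u \<preceq> s \<otimes> ?x" using bruhat_le_gen_mult[OF IH(3) s] xS u by simp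
    show ?thesis
    proof (cases "len ?x < len (s \<otimes> ?x)")
      case True
      have red': "reduced (s # us @ vs)"
      proof (rule reducedI)
        show "s # us @ vs \<in> lists S" using s S by simp
        show "length (s # us @ vs) \<le> len (wp (s # us @ vs))"
          using True reducedD(2)[OF IH(2)] by simp
      qed
      have "?x \<preceq> s \<otimes> ?x" using gen_step[OF s wp_carrier[OF S] True] by (rule r_into_rtranclp)
      then have le: "u \<preceq> wp (s # us @ vs)" using ux rtranclp_trans[of reflection_step u ?x] by auto
      have split: "s # ws = (s # us) @ r # vs" by (simp only: IH(1) append_Cons)
      have "reduced ((s # us) @ vs)" "u \<preceq> wp ((s # us) @ vs)"
        using red' le by (simp_all only: append_Cons)
      with split show ?thesis by (intro exI conjI)
    next
      case False
      then have "len (s \<otimes> ?x) < len ?x"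
        using len_reflection_neq[OF gen_reflection[OF s] wp_carrier[OF S]] by linarith
      then have "s \<otimes> ?x \<preceq> ?x"
        using gen_step[OF s m_closed[OF gen_carrier[OF s] wp_carrier[OF S]]]
          gen_cancel[OF s wp_carrier[OF S]] by (metis r_into_rtranclp)
      then have "u \<preceq> ?x" using ux rtranclp_trans[of reflection_step u "s \<otimes> ?x" ?x] by auto
      moreover have "?x \<preceq> wp ws" by (rule subword_le[OF red]) (simp only: IH(1) subseq_delete)
      ultimately have "u \<preceq> wp ws" by (rule rtranclp_trans)
      then show ?thesis by (rule del_first)
    qed
  qed
qed

end


section \<open>Deletions from a reduced word\<close>

text \<open>
  All reduced words considered from here on are subwords of one fixed reduced word, and are addressed
  by their sets of positions.
\<close>

locale reduced_expression = coxeter_system +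
  fixes ws :: "'a list"
  assumes reduced_ws: "reduced ws"
begin

definition val :: "nat set \<Rightarrow> 'a" where "val K = wp (nths ws K)"

definition F :: "nat set set" where
  "F = {K. K \<subseteq> {..<length ws} \<and> reduced (nths ws K)}"

text \<open>
  Multiplication by \<open>refl_at K a\<close> removes position \<open>a\<close> from \<open>K\<close> or adds it, whichever applies. The
  reflection depends only on the part of \<open>K\<close> before \<open>a\<close>.
\<close>

definition refl_at :: "nat set \<Rightarrow> nat \<Rightarrow> 'a" where
  "refl_at K a = val (K \<inter> {..<a}) \<otimes> ws ! a \<otimes> inv (val (K \<inter> {..<a}))"

lemma nths_lists: "nths ws K \<in> lists S"
  using reducedD(1)[OF reduced_ws] set_nths_subset[of ws K] by (auto simp: in_lists_conv_set)

lemma nth_in_S: "a < length ws \<Longrightarrow> ws ! a \<in> S"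
  using reducedD(1)[OF reduced_ws] by (auto simp: in_lists_conv_set)

lemma val_carrier [simp]: "val K \<in> carrier W"
  unfolding val_def by (rule wp_carrier[OF nths_lists])

lemma F_subset: "K \<in> F \<Longrightarrow> K \<subseteq> {..<length ws}"
  by (simp add: F_def)

lemma F_less: "K \<in> F \<Longrightarrow> a \<in> K \<Longrightarrow> a < length ws"
  using F_subset by blast

lemma F_finite: "K \<in> F \<Longrightarrow> finite K"
  using F_subset finite_subset by blast

lemma len_val_le: assumes "K \<subseteq> {..<length ws}" shows "len (val K) \<le> card K"
  unfolding val_def using len_le[OF nths_lists] length_nths_subset[OF assms] by metis

lemma in_F_iff: assumes "K \<subseteq> {..<length ws}" shows "K \<in> F \<longleftrightarrow> len (val K) = card K"
  using length_nths_subset[OF assms] nths_lists assms by (auto simp: F_def reduced_def val_def)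

lemma len_val: "K \<in> F \<Longrightarrow> len (val K) = card K"
  using in_F_iff[OF F_subset] by blast

lemma refl_at_reflection: assumes "a < length ws" shows "refl_at K a \<in> reflections"
  unfolding refl_at_def reflections_def using nth_in_S[OF assms] val_carrier by blast

lemma refl_at_cong: "K \<inter> {..<a} = L \<inter> {..<a} \<Longrightarrow> refl_at K a = refl_at L a"
  by (simp add: refl_at_def)

lemma refl_at_mult_remove:
  assumes "a \<in> K" "a < length ws" shows "refl_at K a \<otimes> val K = val (K - {a})"
  unfolding refl_at_def val_def
  using delete_letter(1)[of "nths ws (K \<inter> {..<a})" "ws ! a" "nths ws (K \<inter> {a<..})"]
    nths_split_in[OF assms] nths_remove1[OF assms] nths_lists[of K] by metis

lemma refl_at_mult_insert:
  assumes "a \<notin> K" "a < length ws" shows "refl_at K a \<otimes> val K = val (insert a K)"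
proof -
  have same: "refl_at (insert a K) a = refl_at K a" by (rule refl_at_cong) auto
  have "refl_at K a \<otimes> val (insert a K) = val K"
    using refl_at_mult_remove[of a "insert a K"] assms same by simp
  then show ?thesis
    using reflection_cancel[OF refl_at_reflection[OF assms(2), of K] val_carrier] by metis
qed

lemma exchange_position:
  assumes "t \<in> reflections" "len (t \<otimes> val K) < len (val K)"
  obtains c where "c \<in> K" "c < length ws" "t = refl_at K c" "t \<otimes> val K = val (K - {c})"
proof -
  obtain us s vs where e: "nths ws K = us @ s # vs" "t = wp us \<otimes> s \<otimes> inv (wp us)"
    using strong_exchange[OF assms(1) nths_lists] assms(2) unfolding val_def by metis
  obtain c where c: "c \<in> K" "c < length ws" "us = nths ws (K \<inter> {..<c})" "s = ws ! c"
    using nths_eq_append_ConsE[OF e(1)] by metis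
  have "t = refl_at K c" using e(2) c by (simp add: refl_at_def val_def)
  then show ?thesis using that c refl_at_mult_remove by metis
qed

lemma prefix_in_F:
  assumes "K \<in> F" shows "K \<inter> {..<b} \<in> F"
proof (cases "b \<in> K")
  case True
  have "reduced (nths ws (K \<inter> {..<b}) @ ws ! b # nths ws (K \<inter> {b<..}))"
    using assms nths_split_in[OF True F_less[OF assms True]] by (simp add: F_def)
  then show ?thesis using reduced_appendD(1) F_subset[OF assms] by (auto simp: F_def)
next
  case False
  have "reduced (nths ws (K \<inter> {..<b}) @ nths ws (K \<inter> {b<..}))"
    using assms nths_split_notin[OF False, of ws] by (simp add: F_def)
  then show ?thesis using reduced_appendD(1) F_subset[OF assms] by (auto simp: F_def)
qed

text \<open>
  Let \<open>L\<close> be \<open>K\<close> without \<open>a\<close> and \<open>b\<close>, and let \<open>t\<close> be the reflection that puts \<open>a\<close> back. As \<open>K - {b}\<close> is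
  not reduced, \<open>t\<close> shortens \<open>L\<close>, so by exchange it also acts on \<open>L\<close> as the deletion of some \<open>c\<close>. If
  \<open>c < b\<close>, this would shorten the prefix of \<open>K\<close> before \<open>b\<close>, which is reduced. So \<open>c > b\<close>, and putting
  \<open>a\<close> back and removing \<open>c\<close> cancel.
\<close>

lemma later_deletion:
  assumes K: "K \<in> F" and ab: "a \<in> K" "b \<in> K" "a < b" and L: "K - {a, b} \<in> F"
    and nb: "K - {b} \<notin> F"
  obtains c where "c \<in> K" "b < c" "K - {b, c} \<in> F" "val (K - {b, c}) = val (K - {a, b})"
proof -
  note sub = F_subset[OF K] and fin = F_finite[OF K]
  have al: "a < length ws" and bl: "b < length ws" using F_less[OF K] ab by auto
  define L where "L = K - {a, b}"
  define t where "t = refl_at L a"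
  have t: "t \<in> reflections" unfolding t_def by (rule refl_at_reflection[OF al])
  have "insert a L = K - {b}" using ab by (auto simp: L_def)
  then have tL: "t \<otimes> val L = val (K - {b})"
    using refl_at_mult_insert[of a L] al by (simp add: t_def L_def)
  have cL: "len (val L) = card K - 2"
    using len_val[OF L] ab fin by (simp add: L_def card_Diff_subset)
  have "len (val (K - {b})) \<le> card K - 1" "len (val (K - {b})) \<noteq> card K - 1"
    using len_val_le[of "K - {b}"] in_F_iff[of "K - {b}"] nb sub ab fin by auto
  moreover have "len (val (K - {b})) \<noteq> len (val L)"
    using len_reflection_neq[OF t val_carrier[of L]] tL by simp
  ultimately have "len (t \<otimes> val L) < len (val L)" unfolding tL using cL by linarith
  then obtain c where c: "c \<in> L" "c < length ws" "t = refl_at L c" "t \<otimes> val L = val (L - {c})"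
    using exchange_position[OF t] by metis
  have cab: "c \<in> K" "c \<noteq> a" "c \<noteq> b" using c(1) by (auto simp: L_def)
  \<comment> \<open>Otherwise the prefix \<open>K0\<close> before \<open>b\<close> would have the same value as \<open>K0\<close> without \<open>a\<close> and \<open>c\<close>.\<close>
  have "\<not> c < b"
  proof
    assume cb: "c < b"
    define K0 where "K0 = K \<inter> {..<b}"
    have K0: "K0 \<in> F" "a \<in> K0" "c \<in> K0" using prefix_in_F[OF K] ab cab cb by (auto simp: K0_def)
    have "refl_at (K0 - {a}) a = t"
      unfolding t_def by (rule refl_at_cong) (use ab in \<open>auto simp: K0_def L_def\<close>)
    then have "t \<otimes> val (K0 - {a}) = val K0"
      using refl_at_mult_insert[of a "K0 - {a}"] al K0(2) by (simp add: insert_absorb)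
    moreover have "refl_at (K0 - {a}) c = t"
      unfolding c(3) by (rule refl_at_cong) (use cb in \<open>auto simp: K0_def L_def\<close>)
    then have "t \<otimes> val (K0 - {a}) = val (K0 - {a} - {c})"
      using refl_at_mult_remove[of c "K0 - {a}"] c(2) K0(3) cab by simp
    ultimately have "card K0 = len (val (K0 - {a} - {c}))" using len_val[OF K0(1)] by simp
    also have "\<dots> \<le> card (K0 - {a} - {c})"
      using F_subset[OF K0(1)] by (intro len_val_le) auto
    also have "\<dots> < card K0"
      using K0 F_finite[OF K0(1)] by (intro psubset_card_mono) auto
    finally show False by simp
  qed
  then have bc: "b < c" using cab by simp
  have eq: "insert a (L - {c}) = K - {b, c}" using ab bc by (auto simp: L_def)
  have "refl_at (L - {c}) a = t"
    unfolding t_def by (rule refl_at_cong) (use ab bc in auto)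
  then have "t \<otimes> val (L - {c}) = val (K - {b, c})"
    using refl_at_mult_insert[of a "L - {c}"] al by (simp add: L_def flip: eq)
  then have v: "val (K - {b, c}) = val L"
    using c(4) reflection_cancel[OF t val_carrier[of L]] by simp
  have "card (K - {b, c}) = card L"
    using ab cab fin by (simp add: L_def card_Diff_subset)
  then have "len (val (K - {b, c})) = card (K - {b, c})" using v len_val[OF L] by (simp add: L_def)
  then have "K - {b, c} \<in> F" using in_F_iff[of "K - {b, c}"] sub by auto
  then show ?thesis using that cab bc v by (simp add: L_def)
qed

lemma val_le: assumes "K \<in> F" "L \<subseteq> K" shows "val L \<preceq> val K"
  unfolding val_def using assms subseq_nths_mono by (intro subword_le) (auto simp: F_def)

lemma coatom_position:
  assumes "K \<in> F" "u \<preceq> val K" "u \<noteq> val K"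
  obtains q where "q \<in> K" "K - {q} \<in> F" "u \<preceq> val (K - {q})"
proof -
  have "reduced (nths ws K)" using assms(1) by (simp add: F_def)
  then obtain us s vs where e: "nths ws K = us @ s # vs" "reduced (us @ vs)" "u \<preceq> wp (us @ vs)"
    using reduced_coatom assms(2,3) unfolding val_def by blast
  obtain c where c: "c \<in> K" "c < length ws" "us = nths ws (K \<inter> {..<c})"
    "vs = nths ws (K \<inter> {c<..})"
    using nths_eq_append_ConsE[OF e(1)] by metis
  have "nths ws (K - {c}) = us @ vs" using nths_remove1[OF c(1,2)] c by simp
  then show ?thesis using that[of c] c(1) e F_subset[OF assms(1)] by (auto simp: F_def val_def)
qed

text \<open>
  For a pair with the largest possible \<open>b\<close>, the set \<open>K - {b}\<close> must be admissible, since otherwise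
  \<open>later_deletion\<close> yields a pair reaching further to the right. Then \<open>b\<close> is itself a candidate for
  \<open>q\<close>.
\<close>

lemma last_deletion_maximal:
  assumes K: "K \<in> F" and q: "\<And>p. p \<in> K \<Longrightarrow> K - {p} \<in> F \<Longrightarrow> u \<preceq> val (K - {p}) \<Longrightarrow> p \<le> q"
    and ab: "a \<in> K" "b \<in> K" "a < b" and L: "K - {a, b} \<in> F" "u \<preceq> val (K - {a, b})"
  shows "b \<le> q"
  using ab L
proof (induction "length ws - b" arbitrary: a b rule: less_induct)
  case less
  show ?case
  proof (cases "K - {b} \<in> F")
    case True
    have "val (K - {a, b}) \<preceq> val (K - {b})" by (rule val_le[OF True]) auto
    then have "u \<preceq> val (K - {b})" using less.prems(5) by (rule rtranclp_trans[rotated])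
    then show ?thesis using q less.prems(2) True by blast
  next
    case False
    obtain c where c: "c \<in> K" "b < c" "K - {b, c} \<in> F" "val (K - {b, c}) = val (K - {a, b})"
      using later_deletion[OF K less.prems(1-4) False] .
    have "c < length ws" by (rule F_less[OF K c(1)])
    then have "c \<le> q" using less.hyps[of c b] c less.prems by simp
    then show ?thesis using c(2) by simp
  qed
qed

text \<open>
  Greedy choice of the last deletable position \<open>q\<close>. If the deletion that follows started with a
  position \<open>e > q\<close>, then the pair \<open>q, e\<close> would contradict \<open>last_deletion_maximal\<close>.
\<close>

lemma ex_deletion:
  assumes "K \<in> F" "u \<preceq> val K"
  shows "\<exists>D. D \<subseteq> K \<and> (\<forall>q. K - (D \<inter> {q..}) \<in> F) \<and> val (K - D) = u"
  using assms
proof (induction "card K" arbitrary: K rule: less_induct)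
  case less
  note K = less.prems(1)
  show ?case
  proof (cases "u = val K")
    case True
    then show ?thesis using K by (intro exI[of _ "{}"]) simp
  next
    case False
    define Q where "Q = {q \<in> K. K - {q} \<in> F \<and> u \<preceq> val (K - {q})}"
    have "Q \<noteq> {}" using coatom_position[OF K less.prems(2) False] unfolding Q_def by blast
    moreover have finQ: "finite Q" using F_finite[OF K] by (simp add: Q_def)
    ultimately have "Max Q \<in> Q" by (intro Max_in)
    then obtain q where q: "q = Max Q" "q \<in> K" "K - {q} \<in> F" "u \<preceq> val (K - {q})"
      unfolding Q_def by blast
    have q_max: "p \<le> q" if "p \<in> K" "K - {p} \<in> F" "u \<preceq> val (K - {p})" for p
      unfolding q(1) using that finQ by (intro Max_ge) (auto simp: Q_def)
    have "card (K - {q}) < card K" using F_finite[OF K] q(2) by (rule card_Diff1_less)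
    then obtain D where D: "D \<subseteq> K - {q}" "\<And>r. K - {q} - (D \<inter> {r..}) \<in> F" "val (K - {q} - D) = u"
      using less.hyps[OF _ q(3,4)] by blast
    have finD: "finite D" using D(1) F_finite[OF K] finite_subset by blast
    have D_less: "d < q" if "d \<in> D" for d
    proof -
      have ne: "D \<noteq> {}" using that by blast
      define e where "e = Max D"
      have e: "e \<in> D" "\<And>d. d \<in> D \<Longrightarrow> d \<le> e" using finD ne by (simp_all add: e_def)
      have "D \<inter> {e..} = {e}" using e by (auto intro: antisym)
      moreover have "K - {q} - {e} = K - {q, e}" by auto
      ultimately have eF: "K - {q, e} \<in> F" using D(2)[of e] by (simp only:)
      have "val (K - {q} - D) \<preceq> val (K - {q, e})" by (rule val_le[OF eF]) (use e in auto)
      then have ue: "u \<preceq> val (K - {q, e})" using D(3) by simp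
      have eK: "e \<in> K" "e \<noteq> q" using e(1) D(1) by auto
      have "\<not> q < e"
        using last_deletion_maximal[OF K q_max q(2) eK(1) _ eF ue] by force
      then show ?thesis using e(2)[OF that] eK(2) by simp
    qed
    have "K - (insert q D \<inter> {r..}) \<in> F" for r
    proof (cases "r \<le> q")
      case True
      then have "K - (insert q D \<inter> {r..}) = K - {q} - (D \<inter> {r..})" by auto
      then show ?thesis using D(2) by simp
    next
      case False
      then have "K - (insert q D \<inter> {r..}) = K" using D_less by force
      then show ?thesis using K by simp
    qed
    moreover have "K - insert q D = K - {q} - D" by auto
    ultimately show ?thesis using D(1,3) q(2) by (intro exI[of _ "insert q D"]) auto
  qed
qed

lemma nths_Min:
  assumes "K \<subseteq> {..<length ws}" "X \<subseteq> K" "Min K \<in> X"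
  shows "nths ws X = ws ! Min K # nths ws (X - {Min K})"
proof -
  let ?k = "Min K"
  have fin: "finite K" using assms(1) finite_subset by blast
  have k: "?k < length ws" using assms by auto
  have ge: "?k \<le> x" if "x \<in> X" for x using that assms(2) fin by auto
  have "X \<inter> {..<?k} = {}" using ge by force
  moreover have "X \<inter> {?k<..} = X - {?k}" using ge by force
  ultimately show ?thesis using nths_split_in[OF assms(3) k] by simp
qed

lemma remove_Min_in_F:
  assumes "K \<subseteq> {..<length ws}" "X \<in> F" "X \<subseteq> K" shows "X - {Min K} \<in> F"
proof (cases "Min K \<in> X")
  case True
  then have "reduced (ws ! Min K # nths ws (X - {Min K}))"
    using nths_Min[OF assms(1,3) True] assms(2) by (simp add: F_def)
  then show ?thesis using reduced_ConsD F_subset[OF assms(2)] by (auto simp: F_def)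
qed (use assms(2) in simp)

text \<open>
  If the first letter \<open>s\<close> is deleted, it is deleted last, so just before that the word is \<open>s\<close> followed
  by a word of \<open>x\<close> and is reduced: \<open>s\<close> lengthens \<open>x\<close>. If \<open>s\<close> is kept, then \<open>x\<close> has a reduced word
  beginning with \<open>s\<close>, which \<open>s\<close> shortens. So \<open>x\<close> determines the fate of the first letter.
\<close>

lemma Min_deleted_iff:
  assumes K: "K \<in> F" "K \<noteq> {}" and D: "D \<subseteq> K" "\<And>q. K - (D \<inter> {q..}) \<in> F"
  defines "x \<equiv> val (K - D)" and "s \<equiv> ws ! Min K"
  shows "Min K \<in> D \<longleftrightarrow> len x < len (s \<otimes> x)"
    and "val (K - D - {Min K}) = (if Min K \<in> D then x else s \<otimes> x)"
proof -
  note sub = F_subset[OF K(1)]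
  let ?k = "Min K"
  have fin: "finite K" by (rule F_finite[OF K(1)])
  have kK: "?k \<in> K" using K fin by simp
  have s: "s \<in> S" unfolding s_def using kK sub by (intro nth_in_S) auto
  have KD: "K - D \<in> F" using D(2)[of 0] by simp
  have "(?k \<in> D \<longleftrightarrow> len x < len (s \<otimes> x))
      \<and> val (K - D - {?k}) = (if ?k \<in> D then x else s \<otimes> x)"
  proof (cases "?k \<in> D")
    case True
    \<comment> \<open>The stage just before the first letter is deleted.\<close>
    define X where "X = K - (D \<inter> {Suc ?k..})"
    have X: "X \<in> F" "X \<subseteq> K" "?k \<in> X" using D(2) kK by (auto simp: X_def)
    have "?k \<le> d" if "d \<in> D" for d using that D(1) fin by auto
    then have XD: "X - {?k} = K - D" using True by (force simp: X_def)
    have vX: "val X = s \<otimes> x"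
      using nths_Min[OF sub X(2,3)] unfolding XD by (simp add: val_def x_def s_def)
    have "card (K - D) < card X"
      unfolding XD[symmetric] using X(3) F_finite[OF X(1)] by (intro card_Diff1_less)
    then have "len x < len (s \<otimes> x)" using len_val[OF X(1)] len_val[OF KD] vX by (simp add: x_def)
    moreover have "K - D - {?k} = K - D" using True by auto
    ultimately show ?thesis using True by (simp add: x_def)
  next
    case False
    then have kX: "?k \<in> K - D" using kK by simp
    have "x = s \<otimes> val (K - D - {?k})"
      using nths_Min[OF sub _ kX] by (simp add: val_def x_def s_def)
    then have v: "val (K - D - {?k}) = s \<otimes> x" using s by simp
    have "len (s \<otimes> x) = card (K - D - {?k})"
      using len_val[OF remove_Min_in_F[OF sub KD]] v by auto
    also have "\<dots> < card (K - D)" using kX fin by (intro card_Diff1_less) auto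
    finally show ?thesis using len_val[OF KD] v False by (simp add: x_def)
  qed
  then show "?k \<in> D \<longleftrightarrow> len x < len (s \<otimes> x)"
    and "val (K - D - {?k}) = (if ?k \<in> D then x else s \<otimes> x)" by blast+
qed

text \<open>
  After the first letter is settled, removing it from all words leaves two decreasing deletions from
  a shorter word with a common result.
\<close>

lemma deletion_determined:
  assumes "K \<in> F" "D \<subseteq> K" "\<And>q. K - (D \<inter> {q..}) \<in> F"
    and "E \<subseteq> K" "\<And>q. K - (E \<inter> {q..}) \<in> F" and "val (K - D) = val (K - E)"
  shows "D = E"
  using assms
proof (induction "card K" arbitrary: K D E rule: less_induct)
  case less
  note K = less.prems(1)
  show ?case
  proof (cases "K = {}")
    case True
    then show ?thesis using less.prems by auto
  next
    case False
    let ?k = "Min K"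
    note sub = F_subset[OF K]
    have fin: "finite K" by (rule F_finite[OF K])
    have kK: "?k \<in> K" using False fin by simp
    note D = Min_deleted_iff[OF K False less.prems(2,3)]
    note E = Min_deleted_iff[OF K False less.prems(4,5)]
    have mem: "?k \<in> D \<longleftrightarrow> ?k \<in> E" using D(1) E(1) less.prems(6) by simp
    have rest: "K - {?k} - (X - {?k}) = K - X - {?k}" for X by auto
    have del: "K - {?k} - ((X - {?k}) \<inter> {q..}) \<in> F" if "\<And>q. K - (X \<inter> {q..}) \<in> F" for X q
    proof -
      have "K - {?k} - ((X - {?k}) \<inter> {q..}) = (K - (X \<inter> {q..})) - {?k}" by auto
      then show ?thesis using remove_Min_in_F[OF sub that[of q]] by auto
    qed
    have "D - {?k} = E - {?k}"
    proof (rule less.hyps)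
      show "card (K - {?k}) < card K" using fin kK by (intro card_Diff1_less)
      show "K - {?k} \<in> F" using remove_Min_in_F[OF sub K] by simp
      show "val (K - {?k} - (D - {?k})) = val (K - {?k} - (E - {?k}))"
        unfolding rest D(2) E(2) mem less.prems(6) ..
    qed (use less.prems del in auto)
    then show ?thesis using mem by auto
  qed
qed

lemma interval_iff:
  "(x, y) \<in> bruhat_interval W S \<one> (wp ws) \<longleftrightarrow> x \<preceq> y \<and> y \<preceq> wp ws"
proof -
  have w: "wp ws \<in> carrier W" by (rule wp_carrier[OF reducedD(1)[OF reduced_ws]])
  have "x \<preceq> wp ws \<and> x \<in> carrier W \<and> y \<in> carrier W \<and> \<one> \<preceq> x \<and> \<one> \<preceq> y"
    if xy: "x \<preceq> y" "y \<preceq> wp ws"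
  proof -
    have y: "y \<in> carrier W" by (rule bruhat_le_carrier1[OF xy(2) w])
    have x: "x \<in> carrier W" by (rule bruhat_le_carrier1[OF xy(1) y])
    show ?thesis using rtranclp_trans[OF xy] x y one_le by simp
  qed
  then show ?thesis unfolding bruhat_interval_def Int_iff mem_Sigma_iff mem_Collect_eq bruhat_iff
    using w by blast
qed

lemma deletion_labelling_interval:
  "deletion_labelling (bruhat_interval W S \<one> (wp ws)) F (length ws) val len"
proof
  have full: "nths ws {..<length ws} = ws" by simp
  show "{..<length ws} \<in> F" using reduced_ws full by (simp add: F_def)
  have "reduced []" using reduced_appendD(1)[of "[]" ws] reduced_ws by simp
  then show "{} \<in> F" by (simp add: F_def)
  show "K \<subseteq> {..<length ws}" if "K \<in> F" for K by (rule F_subset[OF that])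
  show "trans (bruhat_interval W S \<one> (wp ws))"
    by (rule transI) (auto simp: interval_iff intro: rtranclp_trans)
  have top: "val {..<length ws} = wp ws" using full by (simp add: val_def)
  show "(x, val {..<length ws}) \<in> bruhat_interval W S \<one> (wp ws)"
    if "x \<in> Field (bruhat_interval W S \<one> (wp ws))" for x
    using that rtranclp_trans[of reflection_step] by (auto simp: Field_def interval_iff top)
  have below: "val K \<preceq> wp ws" for K
    unfolding val_def
    by (rule subword_le[OF reduced_ws]) (use subseq_nths_mono[of K UNIV ws] in \<open>simp add: nths_all\<close>)
  show "(val L, val K) \<in> bruhat_interval W S \<one> (wp ws)" if "L \<in> F" "K \<in> F" "L \<subseteq> K" for L K
    using val_le[OF that(2,3)] below by (simp add: interval_iff)
  show "len (val K) = card K" if "K \<in> F" for K by (rule len_val[OF that])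
  show "\<exists>!D. D \<subseteq> K \<and> (\<forall>q. K - D \<inter> {q..} \<in> F) \<and> val (K - D) = x"
    if "K \<in> F" "(x, val K) \<in> bruhat_interval W S \<one> (wp ws)" for K x
  proof (rule ex_ex1I)
    show "\<exists>D. D \<subseteq> K \<and> (\<forall>q. K - D \<inter> {q..} \<in> F) \<and> val (K - D) = x"
      using ex_deletion that by (simp add: interval_iff)
  next
    fix D E
    assume "D \<subseteq> K \<and> (\<forall>q. K - D \<inter> {q..} \<in> F) \<and> val (K - D) = x"
      and "E \<subseteq> K \<and> (\<forall>q. K - E \<inter> {q..} \<in> F) \<and> val (K - E) = x"
    then show "D = E" using deletion_determined[OF that(1), of D E] by simp
  qed
qed

end


section \<open>Comparison with the Boolean algebra\<close>

text \<open>
  In the Boolean algebra every set of positions is admissible. The shift by \<open>Suc\<close> matches the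
  positions, counted from 0, with the ground set \<open>{1..n}\<close>.
\<close>

lemma deletion_labelling_boolean:
  "deletion_labelling (boolean_poset n) (Pow {..<n}) n ((`) Suc) card"
proof
  have ran: "Suc ` {..<n} = {1..n}" by (simp add: image_Suc_lessThan)
  show "trans (boolean_poset n)" by (rule transI) (auto simp: boolean_poset_def)
  show "(x, Suc ` {..<n}) \<in> boolean_poset n" if "x \<in> Field (boolean_poset n)" for x
    using that unfolding ran by (auto simp: boolean_poset_def Field_def)
  show "(Suc ` L, Suc ` K) \<in> boolean_poset n" if "L \<in> Pow {..<n}" "K \<in> Pow {..<n}" "L \<subseteq> K" for L K
    using that image_mono[of K "{..<n}" Suc] unfolding ran by (auto simp: boolean_poset_def)
  show "\<exists>!D. D \<subseteq> K \<and> (\<forall>q. K - D \<inter> {q..} \<in> Pow {..<n}) \<and> Suc ` (K - D) = x"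
    if K: "K \<in> Pow {..<n}" and x: "(x, Suc ` K) \<in> boolean_poset n" for K x
  proof -
    have "x \<subseteq> Suc ` K" using x by (simp add: boolean_poset_def)
    then obtain X where X: "X \<subseteq> K" "x = Suc ` X" by (auto simp: subset_image_iff)
    have "Suc ` (K - D) = x \<longleftrightarrow> K - D = X" for D
      unfolding X(2) by (rule inj_image_eq_iff) simp
    then show ?thesis using X(1) K by (intro ex1I[of _ "K - X"]) auto
  qed
qed (auto simp: card_image)

lemma lookup_ab_index:
  "Poly_Mapping.lookup (ab_index r) u
    = (\<Sum>S \<in> {S \<in> Pow {1..poset_rank r - 1}. ab_monomial (poset_rank r - 1) S = u}. flag_h r S)"
  by (simp add: ab_index_def Let_def lookup_sum lookup_single when_def sum.If_cases Int_def)

theorem theorem7p5: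
  fixes W :: "('a, 'b) monoid_scheme" and S :: "'a set" and m :: "'a \<Rightarrow> 'a \<Rightarrow> enat" and w :: 'a
  assumes "coxeter_system W S m"
    and "w \<in> carrier W" and "w \<noteq> \<one>\<^bsub>W\<^esub>"
  shows "coeffwise_le (ab_index (bruhat_interval W S \<one>\<^bsub>W\<^esub> w))
           (ab_index (boolean_poset (cox_length W S w)))
       \<and> (\<forall>T \<subseteq> {1..cox_length W S w - 1}.
            flag_h (bruhat_interval W S \<one>\<^bsub>W\<^esub> w) T \<le> flag_h (boolean_poset (cox_length W S w)) T)"
proof -
  interpret coxeter_system W S m by (rule assms(1))
  obtain ws where ws: "reduced ws" "wp ws = w" by (rule ex_reduced[OF assms(2)])
  interpret reduced_expression W S m ws by unfold_locales (rule ws(1))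
  define n where "n = cox_length W S w"
  have n: "length ws = n" using reducedD(2)[OF ws(1)] ws(2) by (simp add: n_def)
  interpret I: deletion_labelling "bruhat_interval W S \<one>\<^bsub>W\<^esub> w" F n val len
    using deletion_labelling_interval unfolding ws(2) n .
  interpret B: deletion_labelling "boolean_poset n" "Pow {..<n}" n "(`) Suc" card
    by (rule deletion_labelling_boolean)
  have le: "flag_h (bruhat_interval W S \<one>\<^bsub>W\<^esub> w) T \<le> flag_h (boolean_poset n) T"
    if T: "T \<subseteq> {1..n - 1}" for T
  proof -
    have T': "T \<subseteq> {0<..<n}"
    proof
      fix i assume "i \<in> T"
      then have "i \<in> {1..n - 1}" using T by blast
      then show "i \<in> {0<..<n}" by simp linarith
    qed
    have "insertion_orders F {..<n} \<subseteq> insertion_orders (Pow {..<n}) {..<n}"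
      by (auto simp: insertion_orders_def dest: in_set_takeD)
    then have "card {ps \<in> insertion_orders F {..<n}. descents ps = T}
        \<le> card {ps \<in> insertion_orders (Pow {..<n}) {..<n}. descents ps = T}"
      using finite_insertion_orders by (intro card_mono) auto
    then show ?thesis unfolding I.flag_h_eq[OF T'] B.flag_h_eq[OF T'] by simp
  qed
  then have "coeffwise_le (ab_index (bruhat_interval W S \<one>\<^bsub>W\<^esub> w)) (ab_index (boolean_poset n))"
    unfolding coeffwise_le_def lookup_ab_index I.poset_rank_eq B.poset_rank_eq
    by (intro allI sum_mono) auto
  then show ?thesis using le unfolding n_def by blast
qed

end
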